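(* For every constant $C>1$ there exists $\delta>0$, depending only on $C$, such that the following holds. Let $N\ge 1$, let $-\infty=x_0<x_1<\dots<x_N<x_{N+1}=+\infty$, and let $h_1,h_2:\mathbb{R}\to\mathbb{R}$ be continuous functions which are smooth on each interval $]x_j,x_{j+1}[$, $j=0,\dots,N$. Assume that: (1) $\frac1C\le h_i'(x)\le C$ for $i=1,2$ and all $x\in\mathbb{R}\setminus\{x_1,\dots,x_N\}$; (2) $\sup_{\xi,\eta\in\,]-\infty,x_1[}|h_i'(\xi)-h_i'(\eta)|\le\delta$ for $i=1,2$. Then the system $$u_1(x)=h_1(x)-u_1'u_2'-\tfrac{(u_1')^2}{2},\qquad u_2(x)=h_2(x)-u_1'u_2'-\tfrac{(u_2')^2}{2}$$ has a unique admissible solution $u=(u_1,u_2):\mathbb{R}\to\mathbb{R}^2$.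
   Context: Admissible solution: a function $u=(u_1,u_2):\mathbb{R}\to\mathbb{R}^2$ is an admissible solution of the displayed system if: (A1) $u$ is absolutely continuous (on bounded intervals) and its derivative $u'$ satisfies the system at a.e. $x\in\mathbb{R}$; (A2) there is a constant $C'$ such that $|u(x)|\le C'(1+|x|)$ for all $x\in\mathbb{R}$; (A3) at every $y\in\mathbb{R}$ the derivative $u'$ admits right and left limits $u'(y+)$, $u'(y-)$, and at points where $u'$ is discontinuous these limits satisfy at least one of the conditions $u_1'(y+)+u_2'(y+)\le 0$ or $u_1'(y-)+u_2'(y-)\ge 0$. *)

theory Defs
  imports "HOL-Analysis.Analysis"
begin

(* Only meaningful for open S: deriv is the two-sided derivative. *)
definition smooth_on :: "real set \<Rightarrow> (real \<Rightarrow> real) \<Rightarrow> bool" where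
  "smooth_on S f \<longleftrightarrow> (\<forall>k. \<forall>t\<in>S. (deriv ^^ k) f differentiable (at t))"

(* The epsilon-delta definition; the finite families of non-overlapping compact intervals
   are the divisions of subsets of S. This is not the library's absolutely_continuous,
   which is a relation between measures. *)
definition abs_continuous_on :: "real set \<Rightarrow> (real \<Rightarrow> 'a::real_normed_vector) \<Rightarrow> bool" where
  "abs_continuous_on S f \<longleftrightarrow>
     (\<forall>\<epsilon>>0. \<exists>\<delta>>0. \<forall>\<D> T. \<D> division_of T \<and> T \<subseteq> S \<and> (\<Sum>K\<in>\<D>. Sup K - Inf K) < \<delta>
        \<longrightarrow> (\<Sum>K\<in>\<D>. norm (f (Sup K) - f (Inf K))) < \<epsilon>)"

definition diff_points :: "(real \<Rightarrow> real ^ 2) \<Rightarrow> real set" where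
  "diff_points u = {x. u differentiable (at x)}"

(* vector_derivative is unspecified off diff_points u, so limits and continuity of u' are
   taken along diff_points u. That set has full measure when u is locally absolutely
   continuous, hence the limits below are then unique. *)
definition deriv_right_limit :: "(real \<Rightarrow> real ^ 2) \<Rightarrow> real \<Rightarrow> real ^ 2 \<Rightarrow> bool" where
  "deriv_right_limit u y p \<longleftrightarrow>
     ((\<lambda>x. vector_derivative u (at x)) \<longlongrightarrow> p) (at y within ({y<..} \<inter> diff_points u))"

definition deriv_left_limit :: "(real \<Rightarrow> real ^ 2) \<Rightarrow> real \<Rightarrow> real ^ 2 \<Rightarrow> bool" where
  "deriv_left_limit u y p \<longleftrightarrow>
     ((\<lambda>x. vector_derivative u (at x)) \<longlongrightarrow> p) (at y within ({..<y} \<inter> diff_points u))"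

definition deriv_continuous_at :: "(real \<Rightarrow> real ^ 2) \<Rightarrow> real \<Rightarrow> bool" where
  "deriv_continuous_at u y \<longleftrightarrow>
     y \<in> diff_points u \<and>
     continuous (at y within diff_points u) (\<lambda>x. vector_derivative u (at x))"

definition solves_at ::
  "(real \<Rightarrow> real) \<Rightarrow> (real \<Rightarrow> real) \<Rightarrow> (real \<Rightarrow> real ^ 2) \<Rightarrow> real \<Rightarrow> bool" where
  "solves_at h1 h2 u x \<longleftrightarrow>
     u differentiable (at x) \<and>
     (let u' = vector_derivative u (at x) in
        u x $ 1 = h1 x - u' $ 1 * u' $ 2 - (u' $ 1)\<^sup>2 / 2 \<and>
        u x $ 2 = h2 x - u' $ 1 * u' $ 2 - (u' $ 2)\<^sup>2 / 2)"

definition admissible_solution ::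
  "(real \<Rightarrow> real) \<Rightarrow> (real \<Rightarrow> real) \<Rightarrow> (real \<Rightarrow> real ^ 2) \<Rightarrow> bool" where
  "admissible_solution h1 h2 u \<longleftrightarrow>
     (\<forall>a b. abs_continuous_on {a..b} u) \<and>
     (AE x in lebesgue. solves_at h1 h2 u x) \<and>
     (\<exists>C'. \<forall>x. norm (u x) \<le> C' * (1 + \<bar>x\<bar>)) \<and>
     (\<forall>y. \<exists>p q. deriv_right_limit u y p \<and> deriv_left_limit u y q \<and>
        (\<not> deriv_continuous_at u y \<longrightarrow> p $ 1 + p $ 2 \<le> 0 \<or> q $ 1 + q $ 2 \<ge> 0))"

end

theory Submission
  imports Defs
begin

text \<open>Put \<open>w = h - u\<close> and \<open>p = u'\<close>. The system reads \<open>w = F p\<close> with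
  \<open>F p = (p1 p2 + p1\<^sup>2 / 2, p1 p2 + p2\<^sup>2 / 2)\<close>, a map that is two-to-one with fibres \<open>{p, - p}\<close>,
  so \<open>p\<close> can jump only by a change of sign, and admissibility leaves only jumps from
  \<open>p1 + p2 \<ge> 0\<close> to \<open>p1 + p2 \<le> 0\<close>.

  Uniqueness. Since \<open>w' = h' - p\<close> and \<open>h' \<ge> 1 / C\<close>, the set \<open>w1, w2 > 0\<close> is forward invariant. If
  \<open>p\<close> enters the negative quadrant it stays there and \<open>w\<close> grows superlinearly to the right. If
  \<open>w1, w2 > 0\<close> fails at some point, then to the left of it \<open>p\<close> alternates between the second and
  fourth quadrants, \<open>w\<close> tends to infinity, and \<open>\<bar>w1 - w2\<bar>\<close> grows superlinearly. Both
  contradict linear growth, so \<open>p\<close> lies in the positive quadrant everywhere and is bounded. There \<open>F\<close> is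
  strongly monotone, so the distance of two solutions grows exponentially to the left, which is
  impossible for bounded \<open>w\<close>.

  Existence. Write \<open>P\<close> for the inverse of \<open>F\<close> on the positive quadrant. A solution of
  \<open>u' = P (h - u)\<close> on the whole line with \<open>h - u\<close> in a fixed square is a fixed point of
  \<open>w \<mapsto> h - \<integral> exp (l (t - x)) (l (h - w) + P w) dt\<close>, the integral being over \<open>t \<le> x\<close>. For large
  \<open>l\<close> this maps functions with values in the square to such functions, because \<open>h' - P\<close> points
  inwards on its boundary, and it is a contraction in the supremum norm, because \<open>P\<close> is strongly
  monotone.\<close>

subsection \<open>From local to global estimates\<close>

text \<open>Bolzano bisection: on a short interval around \<open>x\<close> the two one-sided
  estimates are chained through \<open>x\<close>. It replaces the integration of a differential
  inequality when the derivative jumps or is known only through one-sided slopes.\<close>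

lemma local_to_global:
  fixes P :: "real \<Rightarrow> real \<Rightarrow> bool"
  assumes "a \<le> b"
    and refl: "\<And>x. P x x"
    and trans: "\<And>x y z. P x y \<Longrightarrow> x \<le> y \<Longrightarrow> P y z \<Longrightarrow> y \<le> z \<Longrightarrow> P x z"
    and left: "\<And>x. a < x \<Longrightarrow> x \<le> b \<Longrightarrow> \<forall>\<^sub>F s in at_left x. P s x"
    and right: "\<And>x. a \<le> x \<Longrightarrow> x < b \<Longrightarrow> \<forall>\<^sub>F t in at_right x. P x t"
  shows "P a b"
proof -
  have "a \<le> a \<and> b \<le> b \<longrightarrow> P a b"
    using \<open>a \<le> b\<close>
  proof (induction rule: Bolzano[where P = "\<lambda>s t. a \<le> s \<and> t \<le> b \<longrightarrow> P s t"])
    case (trans s m t)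
    then show ?case using assms(3)[of s m t] by simp
  next
    case (local x)
    obtain d1 where d1: "d1 > 0" "a < x \<Longrightarrow> \<forall>s. x - d1 < s \<and> s < x \<longrightarrow> P s x"
    proof (cases "a < x")
      case True
      then obtain c where "c < x" "\<forall>s>c. s < x \<longrightarrow> P s x"
        using left[of x] local by (auto simp: eventually_at_left_field)
      then show thesis using that[of "x - c"] by auto
    qed (use that[of 1] in auto)
    obtain d2 where d2: "d2 > 0" "x < b \<Longrightarrow> \<forall>t. x < t \<and> t < x + d2 \<longrightarrow> P x t"
    proof (cases "x < b")
      case True
      then obtain c where "c > x" "\<forall>t>x. t < c \<longrightarrow> P x t"
        using right[of x] local by (auto simp: eventually_at_right_field)
      then show thesis using that[of "c - x"] by auto
    qed (use that[of 1] in auto)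
    have "P s t" if "s \<le> x" "x \<le> t" "t - s < min d1 d2" "a \<le> s" "t \<le> b" for s t
    proof -
      have "P s x" using d1(2) that refl[of x] by (cases "s = x") auto
      moreover have "P x t" using d2(2) that refl[of x] by (cases "t = x") auto
      ultimately show ?thesis using that assms(3) by blast
    qed
    then show ?case using d1(1) d2(1) by (intro exI[of _ "min d1 d2"]) auto
  qed
  then show ?thesis by simp
qed

lemma growth_from_slopes:
  fixes f :: "real \<Rightarrow> real"
  assumes "a \<le> b"
    and "\<And>x. a < x \<Longrightarrow> x \<le> b \<Longrightarrow> \<forall>\<^sub>F s in at_left x. f s + c * (x - s) \<le> f x"
    and "\<And>x. a \<le> x \<Longrightarrow> x < b \<Longrightarrow> \<forall>\<^sub>F t in at_right x. f x + c * (t - x) \<le> f t"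
  shows "f a + c * (b - a) \<le> f b"
proof (rule local_to_global[where P = "\<lambda>s t. f s + c * (t - s) \<le> f t", OF \<open>a \<le> b\<close>])
  show "f x + c * (z - x) \<le> f z" if "f x + c * (y - x) \<le> f y" "f y + c * (z - y) \<le> f z" for x y z
    using that by (simp add: algebra_simps)
qed (use assms in auto)

lemma right_derivative_slope:
  fixes f :: "real \<Rightarrow> real"
  assumes "(f has_real_derivative a) (at_right y)"
  shows right_derivative_slope_upper: "a < c \<Longrightarrow> \<forall>\<^sub>F t in at_right y. f t \<le> f y + c * (t - y)"
    and right_derivative_slope_lower: "c < a \<Longrightarrow> \<forall>\<^sub>F t in at_right y. f y + c * (t - y) \<le> f t"
proof -
  have lim: "((\<lambda>t. (f t - f y) / (t - y)) \<longlongrightarrow> a) (at_right y)"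
    using assms by (simp add: has_field_derivative_iff)
  have gt: "\<forall>\<^sub>F t in at_right y. y < t"
    by (simp add: eventually_at_filter)
  show "\<forall>\<^sub>F t in at_right y. f t \<le> f y + c * (t - y)" if "a < c"
    using order_tendstoD(2)[OF lim that] gt by eventually_elim (simp add: field_simps)
  show "\<forall>\<^sub>F t in at_right y. f y + c * (t - y) \<le> f t" if "c < a"
    using order_tendstoD(1)[OF lim that] gt by eventually_elim (simp add: field_simps)
qed

lemma left_derivative_slope:
  fixes f :: "real \<Rightarrow> real"
  assumes "(f has_real_derivative a) (at_left y)"
  shows left_derivative_slope_upper: "a < c \<Longrightarrow> \<forall>\<^sub>F s in at_left y. f y \<le> f s + c * (y - s)"
    and left_derivative_slope_lower: "c < a \<Longrightarrow> \<forall>\<^sub>F s in at_left y. f s + c * (y - s) \<le> f y"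
proof -
  have lim: "((\<lambda>t. (f t - f y) / (t - y)) \<longlongrightarrow> a) (at_left y)"
    using assms by (simp add: has_field_derivative_iff)
  have lt: "\<forall>\<^sub>F t in at_left y. t < y"
    by (simp add: eventually_at_filter)
  show "\<forall>\<^sub>F s in at_left y. f y \<le> f s + c * (y - s)" if "a < c"
    using order_tendstoD(2)[OF lim that] lt by eventually_elim (simp add: field_simps)
  show "\<forall>\<^sub>F s in at_left y. f s + c * (y - s) \<le> f y" if "c < a"
    using order_tendstoD(1)[OF lim that] lt by eventually_elim (simp add: field_simps)
qed

lemma slope_bounds_isCont:
  fixes h :: "real \<Rightarrow> real"
  assumes "C > 0" and slope: "\<And>x y. x \<le> y \<Longrightarrow> (y - x) / C \<le> h y - h x"
    "\<And>x y. x \<le> y \<Longrightarrow> h y - h x \<le> C * (y - x)"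
  shows "isCont h z"
proof -
  have "C-lipschitz_on UNIV h"
  proof (rule lipschitz_onI)
    show "dist (h s) (h t) \<le> C * dist s t" for s t
    proof (cases "s \<le> t")
      case True
      moreover have "(t - s) / C \<ge> 0" using True \<open>C > 0\<close> by simp
      ultimately show ?thesis using slope[of s t] by (simp add: dist_real_def)
    next
      case False
      moreover have "(s - t) / C \<ge> 0" using False \<open>C > 0\<close> by simp
      ultimately show ?thesis using slope[of t s] by (simp add: dist_real_def)
    qed
  qed (use \<open>C > 0\<close> in simp)
  then show ?thesis
    using lipschitz_on_continuous_on continuous_on_eq_continuous_at by blast
qed

subsection \<open>The quadratic map\<close>

text \<open>The components factor as p (q + p/2) and q (p + q/2). If p and q had opposite signs,
  each of |p| and |q| would be less than half the other.\<close>

lemma quad_both_pos: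
  fixes p q :: real
  assumes "p * q + p\<^sup>2 / 2 > 0" "p * q + q\<^sup>2 / 2 > 0"
  shows "p > 0 \<and> q > 0 \<or> p < 0 \<and> q < 0"
proof -
  have 1: "p * (q + p / 2) > 0" and 2: "q * (p + q / 2) > 0"
    using assms by (simp_all add: power2_eq_square algebra_simps)
  then show ?thesis by (auto simp: zero_less_mult_iff)
qed

lemma quad_some_neg:
  fixes p q :: real
  assumes "p * q + p\<^sup>2 / 2 < 0 \<or> p * q + q\<^sup>2 / 2 < 0"
  shows "p > 0 \<and> q < 0 \<or> p < 0 \<and> q > 0"
proof -
  have "p * q < 0"
    using assms by (smt (verit) zero_le_power2 divide_nonneg_nonneg)
  then show ?thesis by (auto simp: mult_less_0_iff)
qed

text \<open>Otherwise q = - p/2, where the second component is - 3 p^2 / 8. On an edge of the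
  quadrant of \<open>w\<close> this makes the matching component of the derivative zero.\<close>

lemma quad_boundary:
  fixes p q :: real
  assumes "p * q + p\<^sup>2 / 2 = 0" "p * q + q\<^sup>2 / 2 \<ge> 0"
  shows "p = 0"
proof (rule ccontr)
  assume "p \<noteq> 0"
  moreover have "p * (q + p / 2) = 0"
    using assms(1) by (simp add: power2_eq_square algebra_simps)
  ultimately have "q = - p / 2" by auto
  then have "p * q + q\<^sup>2 / 2 = - (3 / 8) * p\<^sup>2" by (simp add: power2_eq_square)
  moreover have "p\<^sup>2 > 0" using \<open>p \<noteq> 0\<close> by simp
  ultimately show False using assms(2) by linarith
qed

text \<open>With \<open>s = p + q\<close> and \<open>d = p - q\<close> the two components of the quadratic map determine
  \<open>s * d\<close> and \<open>3 * s\<^sup>2 - d\<^sup>2\<close>, hence \<open>(s, d)\<close> up to a common sign.\<close>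

lemma quad_two_to_one:
  fixes p q p' q' :: real
  assumes "p * q + p\<^sup>2 / 2 = p' * q' + p'\<^sup>2 / 2" "p * q + q\<^sup>2 / 2 = p' * q' + q'\<^sup>2 / 2"
  shows "p = p' \<and> q = q' \<or> p = - p' \<and> q = - q'"
proof -
  define s d s' d' where defs: "s = p + q" "d = p - q" "s' = p' + q'" "d' = p' - q'"
  have sd: "s * d = s' * d'" and sq: "3 * s\<^sup>2 - d\<^sup>2 = 3 * s'\<^sup>2 - d'\<^sup>2"
    using assms by (simp_all add: defs power2_eq_square algebra_simps)
  have prod: "s\<^sup>2 * d\<^sup>2 = s'\<^sup>2 * d'\<^sup>2" using sd by (metis power_mult_distrib)
  \<comment> \<open>Eliminating d^2 by \<open>sq\<close> turns \<open>prod\<close> into a quadratic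
    in s^2 with the root s'^2. The cofactor vanishes only if s = d' = 0, and then \<open>sq\<close>
    forces s' = 0.\<close>
  have "(s\<^sup>2 - s'\<^sup>2) * (3 * s\<^sup>2 + d'\<^sup>2) = 0"
    using sq prod by algebra
  then consider "s\<^sup>2 = s'\<^sup>2" | "3 * s\<^sup>2 + d'\<^sup>2 = 0" by auto
  then have "s\<^sup>2 = s'\<^sup>2"
  proof cases
    case 2
    then have "s\<^sup>2 = 0" by (smt (verit) zero_le_power2)
    then show ?thesis using 2 sq by (smt (verit) zero_le_power2)
  qed
  then have "s = s' \<or> s = - s'" "d\<^sup>2 = d'\<^sup>2" using sq by (auto simp: power2_eq_iff)
  then have "s = s' \<and> d = d' \<or> s = - s' \<and> d = - d'"
    using sd by (auto simp: power2_eq_iff)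
  then show ?thesis by (auto simp: defs)
qed

text \<open>When p and q do not have opposite signs, w1 + w2 and (p + q)^2 are comparable, so size
  bounds pass from \<open>w\<close> to the derivative and back.\<close>

lemma quad_sum_le:
  fixes p q :: real
  assumes "p * q \<ge> 0"
  shows "(p * q + p\<^sup>2 / 2) + (p * q + q\<^sup>2 / 2) \<le> (p + q)\<^sup>2"
    and "(p + q)\<^sup>2 \<le> 2 * ((p * q + p\<^sup>2 / 2) + (p * q + q\<^sup>2 / 2))"
proof -
  show "(p * q + p\<^sup>2 / 2) + (p * q + q\<^sup>2 / 2) \<le> (p + q)\<^sup>2"
    using zero_le_power2[of p] zero_le_power2[of q] unfolding power2_sum by linarith
  show "(p + q)\<^sup>2 \<le> 2 * ((p * q + p\<^sup>2 / 2) + (p * q + q\<^sup>2 / 2))"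
    using assms by (simp add: power2_sum field_simps)
qed

text \<open>The increment of a quadratic map is its derivative at the midpoint applied to the increment
  of the argument.\<close>

lemma quad_monotone:
  fixes p q p' q' :: real
  assumes pos: "p > 0" "q > 0" "p' > 0" "q' > 0"
  defines "v1 \<equiv> (p * q + p\<^sup>2 / 2) - (p' * q' + p'\<^sup>2 / 2)"
    and "v2 \<equiv> (p * q + q\<^sup>2 / 2) - (p' * q' + q'\<^sup>2 / 2)"
    and "S \<equiv> (p + q + p' + q') / 2"
  shows quad_strongly_monotone: "S / 2 * ((p - p')\<^sup>2 + (q - q')\<^sup>2) \<le> v1 * (p - p') + v2 * (q - q')"
    and quad_lipschitz: "v1\<^sup>2 + v2\<^sup>2 \<le> 4 * S\<^sup>2 * ((p - p')\<^sup>2 + (q - q')\<^sup>2)"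
proof -
  define x y m n where defs: "x = p - p'" "y = q - q'" "m = (p + p') / 2" "n = (q + q') / 2"
  have S: "S = m + n" by (simp add: S_def defs field_simps)
  have v1: "v1 = S * x + m * y" and v2: "v2 = n * x + S * y"
    by (simp_all add: v1_def v2_def S_def defs power2_eq_square field_simps)
  have mn: "m > 0" "n > 0" using pos by (simp_all add: defs)
  \<comment> \<open>Because m + n = S, the quadratic form is S (x^2 + x y + y^2), which exceeds half
    of S (x^2 + y^2) by a multiple of a square.\<close>
  have "v1 * x + v2 * y - S / 2 * (x\<^sup>2 + y\<^sup>2) = S / 2 * (x + y)\<^sup>2"
    unfolding v1 v2 S by (simp add: power2_eq_square field_simps)
  also have "\<dots> \<ge> 0" using mn S by simp
  finally show "S / 2 * ((p - p')\<^sup>2 + (q - q')\<^sup>2) \<le> v1 * (p - p') + v2 * (q - q')"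
    by (simp add: defs)
  have bound: "(c * x + d * y)\<^sup>2 \<le> 2 * S\<^sup>2 * (x\<^sup>2 + y\<^sup>2)" if "0 \<le> c" "c \<le> S" "0 \<le> d" "d \<le> S" for c d
  proof -
    have "(a + b)\<^sup>2 \<le> 2 * (a\<^sup>2 + b\<^sup>2)" for a b :: real
      using sum_squares_bound[of a b] by (simp add: power2_sum)
    then have "(c * x + d * y)\<^sup>2 \<le> 2 * ((c * x)\<^sup>2 + (d * y)\<^sup>2)" .
    also have "\<dots> \<le> 2 * (S\<^sup>2 * x\<^sup>2 + S\<^sup>2 * y\<^sup>2)"
      using that unfolding power_mult_distrib by (intro mult_left_mono add_mono mult_right_mono power_mono) auto
    finally show ?thesis by (simp add: algebra_simps)
  qed
  have "v1\<^sup>2 \<le> 2 * S\<^sup>2 * (x\<^sup>2 + y\<^sup>2)" "v2\<^sup>2 \<le> 2 * S\<^sup>2 * (x\<^sup>2 + y\<^sup>2)"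
    using bound[of S m] bound[of n S] mn unfolding v1 v2 S by simp_all
  then show "v1\<^sup>2 + v2\<^sup>2 \<le> 4 * S\<^sup>2 * ((p - p')\<^sup>2 + (q - q')\<^sup>2)"
    by (simp add: defs)
qed

subsection \<open>Solutions with one-sided derivatives\<close>

text \<open>An almost-everywhere solution recast in statements valid at every point:
  \<open>a1\<close>, \<open>a2\<close> are the right derivatives, \<open>b1\<close>,
  \<open>b2\<close> the left ones, and the latter are also the left limits of \<open>a1\<close>,
  \<open>a2\<close>. Slopes of \<open>h1\<close>, \<open>h2\<close> stand in for derivatives, so
  break points need no special treatment.\<close>

locale one_sided_solution =
  fixes C D :: real and h1 h2 u1 u2 a1 a2 b1 b2 :: "real \<Rightarrow> real"
  assumes C_gt_1: "C > 1"
    and h1_slope: "x \<le> y \<Longrightarrow> (y - x) / C \<le> h1 y - h1 x" "x \<le> y \<Longrightarrow> h1 y - h1 x \<le> C * (y - x)"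
    and h2_slope: "x \<le> y \<Longrightarrow> (y - x) / C \<le> h2 y - h2 x" "x \<le> y \<Longrightarrow> h2 y - h2 x \<le> C * (y - x)"
    and right_deriv: "(u1 has_real_derivative a1 x) (at_right x)" "(u2 has_real_derivative a2 x) (at_right x)"
    and left_deriv: "(u1 has_real_derivative b1 x) (at_left x)" "(u2 has_real_derivative b2 x) (at_left x)"
    and right_lim: "(a1 \<longlongrightarrow> a1 x) (at_right x)" "(a2 \<longlongrightarrow> a2 x) (at_right x)"
    and left_lim: "(a1 \<longlongrightarrow> b1 x) (at_left x)" "(a2 \<longlongrightarrow> b2 x) (at_left x)"
    and eq_right: "h1 x - u1 x = a1 x * a2 x + (a1 x)\<^sup>2 / 2" "h2 x - u2 x = a1 x * a2 x + (a2 x)\<^sup>2 / 2"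
    and eq_left: "h1 x - u1 x = b1 x * b2 x + (b1 x)\<^sup>2 / 2" "h2 x - u2 x = b1 x * b2 x + (b2 x)\<^sup>2 / 2"
    and jump: "a1 x = b1 x \<and> a2 x = b2 x \<or> a1 x + a2 x \<le> 0 \<or> b1 x + b2 x \<ge> 0"
    and growth: "\<bar>h1 x - u1 x\<bar> \<le> D * (1 + \<bar>x\<bar>)" "\<bar>h2 x - u2 x\<bar> \<le> D * (1 + \<bar>x\<bar>)"
begin

text \<open>The system is symmetric in its two components; facts about \<open>w1\<close> are
  transferred to \<open>w2\<close> through this.\<close>

lemma swap: "one_sided_solution C D h2 h1 u2 u1 a2 a1 b2 b1"
proof
  show "a2 x = b2 x \<and> a1 x = b1 x \<or> a2 x + a1 x \<le> 0 \<or> 0 \<le> b2 x + b1 x" for x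
    using jump[of x] by linarith
qed (fact C_gt_1 h1_slope h2_slope right_deriv left_deriv right_lim left_lim growth
    | simp add: eq_right mult.commute; fail | simp add: eq_left mult.commute; fail)+

abbreviation "w1 x \<equiv> h1 x - u1 x"
abbreviation "w2 x \<equiv> h2 x - u2 x"

lemma D_nonneg: "D \<ge> 0"
  using growth(1)[of 0] by simp

text \<open>\<open>w1\<close> need not have one-sided derivatives, since \<open>h1\<close> is
  controlled only by difference quotients. Hence only rates \<open>c\<close> strictly beyond the
  extreme slopes are claimed.\<close>

lemma w1_slope:
  shows w1_right_lower: "c < 1 / C - a1 x \<Longrightarrow> \<forall>\<^sub>F t in at_right x. w1 x + c * (t - x) \<le> w1 t"
    and w1_right_upper: "C - a1 x < c \<Longrightarrow> \<forall>\<^sub>F t in at_right x. w1 t \<le> w1 x + c * (t - x)"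
    and w1_left_lower: "c < 1 / C - b1 x \<Longrightarrow> \<forall>\<^sub>F s in at_left x. w1 s + c * (x - s) \<le> w1 x"
    and w1_left_upper: "C - b1 x < c \<Longrightarrow> \<forall>\<^sub>F s in at_left x. w1 x \<le> w1 s + c * (x - s)"
proof -
  have gt: "\<forall>\<^sub>F t in at_right x. x < t" and lt: "\<forall>\<^sub>F t in at_left x. t < x"
    by (simp_all add: eventually_at_filter)
  show "\<forall>\<^sub>F t in at_right x. w1 x + c * (t - x) \<le> w1 t" if "c < 1 / C - a1 x"
  proof -
    have "\<forall>\<^sub>F t in at_right x. u1 t \<le> u1 x + (1 / C - c) * (t - x)"
      using right_derivative_slope_upper[OF right_deriv(1), of x "1 / C - c"] that by simp
    then show ?thesis using gt
    proof eventually_elim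
      case (elim t)
      then show ?case using h1_slope(1)[of x t] by (simp add: algebra_simps diff_divide_distrib)
    qed
  qed
  show "\<forall>\<^sub>F t in at_right x. w1 t \<le> w1 x + c * (t - x)" if "C - a1 x < c"
  proof -
    have "\<forall>\<^sub>F t in at_right x. u1 x + (C - c) * (t - x) \<le> u1 t"
      using right_derivative_slope_lower[OF right_deriv(1), of "C - c" x] that by simp
    then show ?thesis using gt
    proof eventually_elim
      case (elim t)
      then show ?case using h1_slope(2)[of x t] by (simp add: algebra_simps diff_divide_distrib)
    qed
  qed
  show "\<forall>\<^sub>F s in at_left x. w1 s + c * (x - s) \<le> w1 x" if "c < 1 / C - b1 x"
  proof -
    have "\<forall>\<^sub>F s in at_left x. u1 x \<le> u1 s + (1 / C - c) * (x - s)"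
      using left_derivative_slope_upper[OF left_deriv(1), of x "1 / C - c"] that by simp
    then show ?thesis using lt
    proof eventually_elim
      case (elim s)
      then show ?case using h1_slope(1)[of s x] by (simp add: algebra_simps diff_divide_distrib)
    qed
  qed
  show "\<forall>\<^sub>F s in at_left x. w1 x \<le> w1 s + c * (x - s)" if "C - b1 x < c"
  proof -
    have "\<forall>\<^sub>F s in at_left x. u1 s + (C - c) * (x - s) \<le> u1 x"
      using left_derivative_slope_lower[OF left_deriv(1), of "C - c" x] that by simp
    then show ?thesis using lt
    proof eventually_elim
      case (elim s)
      then show ?case using h1_slope(2)[of s x] by (simp add: algebra_simps diff_divide_distrib)
    qed
  qed
qed

lemmas w2_right_lower = one_sided_solution.w1_right_lower[OF swap]
  and w2_right_upper = one_sided_solution.w1_right_upper[OF swap]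
  and w2_left_lower = one_sided_solution.w1_left_lower[OF swap]
  and w2_left_upper = one_sided_solution.w1_left_upper[OF swap]

lemma isCont_w1: "isCont w1 x"
proof -
  have "isCont h1 x"
    using slope_bounds_isCont[of C h1] h1_slope C_gt_1 by auto
  moreover have "isCont u1 x"
    using left_deriv(1)[of x] right_deriv(1)[of x] continuous_at_split
      has_field_derivative_imp_has_derivative has_derivative_continuous by blast
  ultimately show ?thesis by simp
qed

lemma isCont_w2: "isCont w2 x"
  by (rule one_sided_solution.isCont_w1[OF swap])

lemma w_tendsto:
  "(w1 \<longlongrightarrow> w1 x) (at_left x)" "(w2 \<longlongrightarrow> w2 x) (at_left x)"
  "(w1 \<longlongrightarrow> w1 x) (at_right x)" "(w2 \<longlongrightarrow> w2 x) (at_right x)"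
  using isCont_w1[of x] isCont_w2[of x]
  by (simp_all only: isCont_def filterlim_at_split)

lemma left_eq_right: "b1 x = a1 x \<and> b2 x = a2 x \<or> b1 x = - a1 x \<and> b2 x = - a2 x"
  using quad_two_to_one[of "b1 x" "b2 x" "a1 x" "a2 x"] eq_right[of x] eq_left[of x] by simp

text \<open>At such a boundary point \<open>b1 x = 0\<close> by \<open>quad_boundary\<close>, so
  \<open>w1\<close> climbs through zero; the rate 1/(2C) instead of 1/C leaves the strict margin
  that \<open>w1_left_lower\<close> requires.\<close>

lemma boundary_left_neg:
  assumes "w1 x = 0" "w2 x \<ge> 0"
  shows "\<forall>\<^sub>F s in at_left x. w1 s < 0"
proof -
  have "b1 x = 0"
    using quad_boundary[of "b1 x" "b2 x"] assms eq_left[of x] by simp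
  then have "\<forall>\<^sub>F s in at_left x. w1 s + 1 / (2 * C) * (x - s) \<le> w1 x"
    using C_gt_1 by (intro w1_left_lower) (simp add: field_simps)
  moreover have "\<forall>\<^sub>F s in at_left x. s < x" by (simp add: eventually_at_filter)
  ultimately show ?thesis
  proof eventually_elim
    case (elim s)
    have "1 / (2 * C) * (x - s) > 0" using C_gt_1 elim by simp
    then show ?case using elim assms by linarith
  qed
qed

lemma boundary_right_pos:
  assumes "w1 x = 0" "w2 x \<ge> 0"
  shows "\<forall>\<^sub>F t in at_right x. w1 t > 0"
proof -
  have "a1 x = 0"
    using quad_boundary[of "a1 x" "a2 x"] assms eq_right[of x] by simp
  then have "\<forall>\<^sub>F t in at_right x. w1 x + 1 / (2 * C) * (t - x) \<le> w1 t"
    using C_gt_1 by (intro w1_right_lower) (simp add: field_simps)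
  moreover have "\<forall>\<^sub>F t in at_right x. x < t" by (simp add: eventually_at_filter)
  ultimately show ?thesis
  proof eventually_elim
    case (elim t)
    have "1 / (2 * C) * (t - x) > 0" using C_gt_1 elim by simp
    then show ?case using elim assms by linarith
  qed
qed

text \<open>The propagated property is an implication between two points, hence transitive. Its
  local form on the left is proved by contraposition: if \<open>w\<close> is outside the open
  quadrant at \<open>z\<close>, then by continuity or by the slope on the edges it is outside just
  before \<open>z\<close>.\<close>

lemma positive_forward:
  assumes "w1 x > 0" "w2 x > 0" "x \<le> y"
  shows "w1 y > 0 \<and> w2 y > 0"
proof -
  have "w1 x > 0 \<and> w2 x > 0 \<longrightarrow> w1 y > 0 \<and> w2 y > 0"
  proof (rule local_to_global[where P = "\<lambda>s t. w1 s > 0 \<and> w2 s > 0 \<longrightarrow> w1 t > 0 \<and> w2 t > 0",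
        OF \<open>x \<le> y\<close>])
    fix z
    show "\<forall>\<^sub>F t in at_right z. w1 z > 0 \<and> w2 z > 0 \<longrightarrow> w1 t > 0 \<and> w2 t > 0"
    proof (cases "w1 z > 0 \<and> w2 z > 0")
      case True
      then show ?thesis
        using order_tendstoD(1)[OF w_tendsto(3), of 0 z] order_tendstoD(1)[OF w_tendsto(4), of 0 z]
        by (auto elim: eventually_elim2)
    qed auto
    show "\<forall>\<^sub>F s in at_left z. w1 s > 0 \<and> w2 s > 0 \<longrightarrow> w1 z > 0 \<and> w2 z > 0"
    proof (cases "w1 z > 0 \<and> w2 z > 0")
      case False
      then consider "w1 z < 0" | "w2 z < 0" | "w1 z = 0" "w2 z \<ge> 0" | "w2 z = 0" "w1 z \<ge> 0"
        by linarith
      then have "\<forall>\<^sub>F s in at_left z. w1 s < 0 \<or> w2 s < 0"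
      proof cases
        case 1
        then show ?thesis using order_tendstoD(2)[OF w_tendsto(1), of z 0] by (auto elim: eventually_mono)
      next
        case 2
        then show ?thesis using order_tendstoD(2)[OF w_tendsto(2), of z 0] by (auto elim: eventually_mono)
      next
        case 3
        then show ?thesis using boundary_left_neg[of z] by (auto elim: eventually_mono)
      next
        case 4
        then show ?thesis using one_sided_solution.boundary_left_neg[OF swap, of z] by (auto elim: eventually_mono)
      qed
      then show ?thesis by eventually_elim auto
    qed auto
  qed auto
  then show ?thesis using assms by blast
qed

section \<open>The negative branch leads to superlinear growth to the right\<close>

lemma positive_signs:
  assumes "w1 x > 0" "w2 x > 0"
  shows "a1 x > 0 \<and> a2 x > 0 \<or> a1 x < 0 \<and> a2 x < 0"
  using quad_both_pos[of "a1 x" "a2 x"] assms eq_right[of x] by simp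

lemma negative_imp_positive_w:
  assumes "a1 x < 0" "a2 x < 0"
  shows "w1 x > 0 \<and> w2 x > 0"
proof -
  have "a1 x * a2 x > 0" using assms by (simp add: mult_neg_neg)
  moreover have "(a1 x)\<^sup>2 \<ge> 0" "(a2 x)\<^sup>2 \<ge> 0" by simp_all
  ultimately show ?thesis unfolding eq_right by linarith
qed

text \<open>While both derivatives of \<open>u\<close> are negative, each component of
  \<open>w\<close> gains at least 1/C per unit length. By \<open>positive_forward\<close>,
  \<open>w\<close> stays in its quadrant, so a jump could only lead to the positive branch, which
  \<open>jump\<close> forbids.\<close>

lemma negative_forward:
  assumes "a1 y < 0" "a2 y < 0" "y \<le> z"
  shows "a1 z < 0 \<and> a2 z < 0 \<and> w1 y + (z - y) / C \<le> w1 z \<and> w2 y + (z - y) / C \<le> w2 z"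
proof -
  let ?P = "\<lambda>s t. a1 s < 0 \<and> a2 s < 0 \<longrightarrow>
    a1 t < 0 \<and> a2 t < 0 \<and> w1 s + (t - s) / C \<le> w1 t \<and> w2 s + (t - s) / C \<le> w2 t"
  have "?P y z"
  proof (rule local_to_global[where P = ?P, OF \<open>y \<le> z\<close>])
    fix r s t assume "?P r s" "?P s t"
    then show "?P r t" by (auto simp: diff_divide_distrib)
  next
    fix x
    show "\<forall>\<^sub>F t in at_right x. ?P x t"
    proof (cases "a1 x < 0 \<and> a2 x < 0")
      case True
      have "\<forall>\<^sub>F t in at_right x. a1 t < 0" "\<forall>\<^sub>F t in at_right x. a2 t < 0"
        using order_tendstoD(2)[OF right_lim(1), of x 0] order_tendstoD(2)[OF right_lim(2), of x 0] True by auto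
      moreover have "\<forall>\<^sub>F t in at_right x. w1 x + 1 / C * (t - x) \<le> w1 t"
        "\<forall>\<^sub>F t in at_right x. w2 x + 1 / C * (t - x) \<le> w2 t"
        using True w1_right_lower[of "1 / C" x] w2_right_lower[of "1 / C" x] by auto
      ultimately show ?thesis by eventually_elim simp
    qed auto
    show "\<forall>\<^sub>F s in at_left x. ?P s x"
    proof (cases "w1 x > 0 \<and> w2 x > 0")
      case True
      consider "b1 x < 0 \<and> b2 x < 0" | "b1 x > 0 \<and> b2 x > 0"
        using positive_signs[of x] True left_eq_right[of x] by linarith
      then show ?thesis
      proof cases
        case 1
        then have "a1 x < 0 \<and> a2 x < 0"
          using left_eq_right[of x] jump[of x] by linarith
        moreover have "\<forall>\<^sub>F s in at_left x. w1 s + 1 / C * (x - s) \<le> w1 x"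
          "\<forall>\<^sub>F s in at_left x. w2 s + 1 / C * (x - s) \<le> w2 x"
          using 1 w1_left_lower[of "1 / C" x] w2_left_lower[of "1 / C" x] by auto
        ultimately show ?thesis by (auto elim: eventually_elim2)
      next
        case 2
        then have "\<forall>\<^sub>F s in at_left x. a1 s > 0"
          using order_tendstoD(1)[OF left_lim(1), of 0 x] by simp
        then show ?thesis by eventually_elim auto
      qed
    next
      case False
      have "\<forall>\<^sub>F s in at_left x. s < x" by (simp add: eventually_at_filter)
      then show ?thesis
      proof eventually_elim
        case (elim s)
        then show ?case
          using False positive_forward[of s x] negative_imp_positive_w[of s] by fastforce
      qed
    qed
  qed simp
  then show ?thesis using assms by blast
qed

lemma not_negative: "\<not> (a1 y < 0 \<and> a2 y < 0)"
proof
  assume neg: "a1 y < 0 \<and> a2 y < 0"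
  note fwd = negative_forward[OF neg[THEN conjunct1] neg[THEN conjunct2]]
  \<comment> \<open>The left limit \<open>b1 x\<close> of negative values is not positive, so of the
    two signs in \<open>left_eq_right\<close> only \<open>b = a\<close> remains.\<close>
  have b_neg: "b1 x < 0 \<and> b2 x < 0" if "x > y" for x
  proof -
    have "\<forall>\<^sub>F s in at_left x. y < s" using that by (simp add: eventually_at_left_field) (meson that)
    then have "\<forall>\<^sub>F s in at_left x. a1 s \<le> 0"
      by eventually_elim (use fwd less_imp_le in blast)
    then have "b1 x \<le> 0"
      using tendsto_upperbound[OF left_lim(1)[of x]] by simp
    then show ?thesis using left_eq_right[of x] fwd[of x] that by auto
  qed
  \<comment> \<open>\<open>growth\<close> allows w1 + w2 to grow at rate at most 2 D in the long
    run, which \<open>L\<close> exceeds.\<close>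
  define L where "L = 2 * D + 1"
  have "L > 0" using D_nonneg by (simp add: L_def)
  \<comment> \<open>After a length C L^2 each component of \<open>w\<close> is at least L^2, which
    forces |a1 + a2| to be at least L.\<close>
  define y1 where "y1 = y + C * L\<^sup>2"
  have "y1 > y" using \<open>L > 0\<close> C_gt_1 by (simp add: y1_def)
  have fast: "- (a1 x + a2 x) \<ge> L" if "x \<ge> y1" for x
  proof -
    have "y \<le> x" using that \<open>y1 > y\<close> by linarith
    have "w1 y > 0 \<and> w2 y > 0" using neg negative_imp_positive_w by blast
    then have "w1 x + w2 x \<ge> 2 * ((x - y) / C)" using fwd[OF \<open>y \<le> x\<close>] by linarith
    moreover have "(x - y) / C \<ge> L\<^sup>2" using that C_gt_1 by (simp add: y1_def field_simps)
    moreover have "w1 x + w2 x \<le> (a1 x + a2 x)\<^sup>2"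
      using quad_sum_le(1)[of "a1 x" "a2 x"] fwd[OF \<open>y \<le> x\<close>] eq_right[of x]
      by (simp add: mult_nonpos_nonpos)
    ultimately have "L\<^sup>2 \<le> (- (a1 x + a2 x))\<^sup>2"
      using zero_le_power2[of L] unfolding power2_minus by linarith
    moreover have "0 \<le> - (a1 x + a2 x)" using fwd[OF \<open>y \<le> x\<close>] by linarith
    ultimately show ?thesis by (rule power2_le_imp_le)
  qed
  have grow: "(w1 y1 + w2 y1) + L * (z - y1) \<le> w1 z + w2 z" if "y1 \<le> z" for z
  proof (rule growth_from_slopes[OF that])
    fix x assume x: "y1 \<le> x" "x < z"
    have "\<forall>\<^sub>F t in at_right x. w1 x + (- a1 x) * (t - x) \<le> w1 t"
      "\<forall>\<^sub>F t in at_right x. w2 x + (- a2 x) * (t - x) \<le> w2 t"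
      using C_gt_1 w1_right_lower[of "- a1 x" x] w2_right_lower[of "- a2 x" x] by auto
    moreover have "\<forall>\<^sub>F t in at_right x. x < t" by (simp add: eventually_at_filter)
    ultimately show "\<forall>\<^sub>F t in at_right x. (w1 x + w2 x) + L * (t - x) \<le> w1 t + w2 t"
    proof eventually_elim
      case (elim t)
      have "L * (t - x) \<le> - (a1 x + a2 x) * (t - x)"
        using fast[of x] x elim by (intro mult_right_mono) auto
      then show ?case using elim by (simp add: algebra_simps)
    qed
  next
    fix x assume x: "y1 < x" "x \<le> z"
    have ba: "b1 x = a1 x" "b2 x = a2 x"
      using b_neg[of x] fwd[of x] left_eq_right[of x] x \<open>y1 > y\<close> by linarith+
    have "\<forall>\<^sub>F s in at_left x. w1 s + (- a1 x) * (x - s) \<le> w1 x"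
      "\<forall>\<^sub>F s in at_left x. w2 s + (- a2 x) * (x - s) \<le> w2 x"
      using C_gt_1 ba w1_left_lower[of "- a1 x" x] w2_left_lower[of "- a2 x" x] by auto
    moreover have "\<forall>\<^sub>F s in at_left x. s < x" by (simp add: eventually_at_filter)
    ultimately show "\<forall>\<^sub>F s in at_left x. (w1 s + w2 s) + L * (x - s) \<le> w1 x + w2 x"
    proof eventually_elim
      case (elim s)
      have "L * (x - s) \<le> - (a1 x + a2 x) * (x - s)"
        using fast[of x] x elim by (intro mult_right_mono) auto
      then show ?case using elim by (simp add: algebra_simps)
    qed
  qed
  \<comment> \<open>Large enough for \<open>L * (z - y1)\<close> to overtake the allowed
    \<open>2 * D * (1 + z)\<close>; as L - 2 D = 1, this needs z > 2 D + L y1.\<close>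
  define z where "z = \<bar>y1\<bar> + 2 * D + L * \<bar>y1\<bar> + 1"
  have "L * \<bar>y1\<bar> \<ge> 0" using \<open>L > 0\<close> by simp
  then have "z \<ge> y1" "z \<ge> 0" using D_nonneg unfolding z_def by linarith+
  have "w1 y1 > 0" "w2 y1 > 0"
    using fwd[of y1] negative_imp_positive_w[of y1] \<open>y1 > y\<close> by simp_all
  then have "L * (z - y1) \<le> 2 * D * (1 + z)"
    using grow[OF \<open>z \<ge> y1\<close>] growth[of z] \<open>z \<ge> 0\<close> by (simp add: algebra_simps)
  then have "z \<le> 2 * D + L * y1" by (simp add: L_def algebra_simps)
  moreover have "L * y1 \<le> L * \<bar>y1\<bar>" using \<open>L > 0\<close> by (intro mult_left_mono) auto
  ultimately show False by (simp add: z_def)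
qed

section \<open>Points outside the positive quadrant of \<open>w\<close> lead to superlinear growth
  to the left\<close>

lemma nonpositive_backward:
  assumes "\<not> (w1 y > 0 \<and> w2 y > 0)" "x < y"
  shows "w1 x < 0 \<or> w2 x < 0"
proof (rule ccontr)
  assume "\<not> (w1 x < 0 \<or> w2 x < 0)"
  then have nonneg: "w1 x \<ge> 0" "w2 x \<ge> 0" by auto
  \<comment> \<open>From the closed quadrant \<open>w\<close> enters the open one at once, by
    continuity or by the positive slope on the edges, and \<open>positive_forward\<close> would then
    keep it there up to \<open>y\<close>.\<close>
  have "\<forall>\<^sub>F t in at_right x. w1 t > 0"
    using order_tendstoD(1)[OF w_tendsto(3), of 0 x] boundary_right_pos[of x] nonneg
    by (cases "w1 x = 0") auto
  moreover have "\<forall>\<^sub>F t in at_right x. w2 t > 0"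
    using order_tendstoD(1)[OF w_tendsto(4), of 0 x]
      one_sided_solution.boundary_right_pos[OF swap, of x] nonneg
    by (cases "w2 x = 0") auto
  moreover have "\<forall>\<^sub>F t in at_right x. t < y"
    using \<open>x < y\<close> by (rule order_tendstoD(2)[OF tendsto_ident_at])
  ultimately have "\<forall>\<^sub>F t in at_right x. w1 t > 0 \<and> w2 t > 0 \<and> t < y"
    by eventually_elim simp
  then obtain t where "w1 t > 0" "w2 t > 0" "t < y"
    using eventually_happens'[OF trivial_limit_at_right_real] by blast
  then show False using positive_forward[of t y] assms(1) by simp
qed

text \<open>At a jump \<open>a = - b\<close>, so \<open>jump\<close> reduces to b1 + b2 >= 0. Since
  w1 - w2 is half the product of b1 + b2 and b1 - b2, the quadrant of \<open>b\<close> decides its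
  sign.\<close>

lemma branch_jump_order:
  shows "b1 x > 0 \<Longrightarrow> b2 x < 0 \<Longrightarrow> \<not> a1 x > 0 \<Longrightarrow> w2 x \<le> w1 x"
    and "b1 x < 0 \<Longrightarrow> b2 x > 0 \<Longrightarrow> a1 x > 0 \<Longrightarrow> w1 x \<le> w2 x"
proof -
  have diff: "w1 x - w2 x = (b1 x + b2 x) * (b1 x - b2 x) / 2"
    unfolding eq_left by (simp add: power2_eq_square field_simps)
  show "w2 x \<le> w1 x" if "b1 x > 0" "b2 x < 0" "\<not> a1 x > 0"
  proof -
    have "b1 x + b2 x \<ge> 0" using left_eq_right[of x] jump[of x] that by linarith
    then have "(b1 x + b2 x) * (b1 x - b2 x) \<ge> 0" using that by simp
    then show ?thesis using diff by linarith
  qed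
  show "w1 x \<le> w2 x" if "b1 x < 0" "b2 x > 0" "a1 x > 0"
  proof -
    have "b1 x + b2 x \<ge> 0" using left_eq_right[of x] jump[of x] that by linarith
    then have "(b1 x + b2 x) * (b1 x - b2 x) \<le> 0" using that by (simp add: mult_nonneg_nonpos)
    then show ?thesis using diff by linarith
  qed
qed

text \<open>Left of a point where \<open>w\<close> leaves the open positive quadrant, the derivative lies in the
  second or fourth quadrant and may jump between the two, but by admissibility only from the
  fourth to the second where \<open>w2 \<le> w1\<close> and only back where \<open>w1 \<le> w2\<close>. A quantity that is
  \<open>f4\<close> on one branch and \<open>f2\<close> on the other is therefore monotone if it increases along both
  branches and is ordered correctly at the jumps.\<close>

lemma branch_growth:
  assumes region: "\<And>x. x < X \<Longrightarrow> w1 x < 0 \<or> w2 x < 0"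
    and right4: "\<And>x. x < X \<Longrightarrow> a1 x > 0 \<Longrightarrow> a2 x < 0 \<Longrightarrow> \<forall>\<^sub>F t in at_right x. f4 x + c * (t - x) \<le> f4 t"
    and right2: "\<And>x. x < X \<Longrightarrow> a1 x < 0 \<Longrightarrow> a2 x > 0 \<Longrightarrow> \<forall>\<^sub>F t in at_right x. f2 x + c * (t - x) \<le> f2 t"
    and left4: "\<And>x. x < X \<Longrightarrow> b1 x > 0 \<Longrightarrow> b2 x < 0 \<Longrightarrow> \<forall>\<^sub>F s in at_left x. f4 s + c * (x - s) \<le> f4 x"
    and left2: "\<And>x. x < X \<Longrightarrow> b1 x < 0 \<Longrightarrow> b2 x > 0 \<Longrightarrow> \<forall>\<^sub>F s in at_left x. f2 s + c * (x - s) \<le> f2 x"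
    and jump42: "\<And>x. w2 x \<le> w1 x \<Longrightarrow> f4 x \<le> f2 x"
    and jump24: "\<And>x. w1 x \<le> w2 x \<Longrightarrow> f2 x \<le> f4 x"
    and st: "s \<le> t" "t < X"
  defines "g \<equiv> \<lambda>x. if a1 x > 0 then f4 x else (f2 x :: real)"
  shows "g s + c * (t - s) \<le> g t"
proof (rule growth_from_slopes[OF st(1)])
  fix x assume "s \<le> x" "x < t"
  then have "x < X" using st by simp
  then consider "a1 x > 0" "a2 x < 0" | "a1 x < 0" "a2 x > 0"
    using quad_some_neg[of "a1 x" "a2 x"] region[of x] eq_right[of x] by force
  then show "\<forall>\<^sub>F r in at_right x. g x + c * (r - x) \<le> g r"
  proof cases
    case 1
    have "\<forall>\<^sub>F r in at_right x. a1 r > 0"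
      using order_tendstoD(1)[OF right_lim(1)] 1 by blast
    with right4[OF \<open>x < X\<close> 1] show ?thesis
      by eventually_elim (use 1 in \<open>simp add: g_def\<close>)
  next
    case 2
    have "\<forall>\<^sub>F r in at_right x. a1 r < 0"
      using order_tendstoD(2)[OF right_lim(1)] 2 by blast
    with right2[OF \<open>x < X\<close> 2] show ?thesis
      by eventually_elim (use 2 in \<open>simp add: g_def\<close>)
  qed
next
  fix x assume "s < x" "x \<le> t"
  then have "x < X" using st by simp
  then consider "b1 x > 0" "b2 x < 0" | "b1 x < 0" "b2 x > 0"
    using quad_some_neg[of "b1 x" "b2 x"] region[of x] eq_left[of x] by force
  then show "\<forall>\<^sub>F r in at_left x. g r + c * (x - r) \<le> g x"
  proof cases
    case 1
    \<comment> \<open>\<open>g\<close> is read off the right derivative, so at a jump its value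
      already belongs to the new branch; the jump order makes it no smaller than the old branch at
      \<open>x\<close>.\<close>
    have le: "f4 x \<le> g x"
    proof (cases "a1 x > 0")
      case False
      then have "w2 x \<le> w1 x" using branch_jump_order(1)[OF 1] by simp
      then show ?thesis using False jump42 by (simp add: g_def)
    qed (simp add: g_def)
    have "\<forall>\<^sub>F r in at_left x. a1 r > 0"
      using order_tendstoD(1)[OF left_lim(1)] 1 by blast
    with left4[OF \<open>x < X\<close> 1] show ?thesis
      by eventually_elim (use le in \<open>simp add: g_def\<close>)
  next
    case 2
    have le: "f2 x \<le> g x"
    proof (cases "a1 x > 0")
      case True
      then have "w1 x \<le> w2 x" using branch_jump_order(2)[OF 2] by simp
      then show ?thesis using True jump24 by (simp add: g_def)
    qed (simp add: g_def)
    have "\<forall>\<^sub>F r in at_left x. a1 r < 0"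
      using order_tendstoD(2)[OF left_lim(1)] 2 by blast
    with left2[OF \<open>x < X\<close> 2] show ?thesis
      by eventually_elim (use le in \<open>simp add: g_def\<close>)
  qed
qed

text \<open>Two applications of \<open>branch_growth\<close>. First, the component of
  \<open>w\<close> for which \<open>u\<close> decreases gains at least 1/C per unit length, so it is
  below -B far to the left. This makes |a1 - a2| so large that the difference of the components of
  \<open>w\<close> varies faster than \<open>growth\<close> permits.\<close>

lemma everywhere_positive: "w1 x > 0 \<and> w2 x > 0"
proof (rule ccontr)
  assume not_pos: "\<not> (w1 x > 0 \<and> w2 x > 0)"
  note region = nonpositive_backward[OF not_pos]
  define L where "L = 2 * D + 1"
  define B where "B = (2 * C + L)\<^sup>2"
  have "L > 0" using D_nonneg by (simp add: L_def)
  define g where "g y = (if a1 y > 0 then w2 y else w1 y)" for y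
  have g_growth: "g s + 1 / C * (t - s) \<le> g t" if "s \<le> t" "t < x" for s t
    unfolding g_def
  proof (rule branch_growth[OF region])
    fix y
    show "\<forall>\<^sub>F t in at_right y. w2 y + 1 / C * (t - y) \<le> w2 t" if "a2 y < 0"
      using that by (intro w2_right_lower) simp
    show "\<forall>\<^sub>F t in at_right y. w1 y + 1 / C * (t - y) \<le> w1 t" if "a1 y < 0"
      using that by (intro w1_right_lower) simp
    show "\<forall>\<^sub>F s in at_left y. w2 s + 1 / C * (y - s) \<le> w2 y" if "b2 y < 0"
      using that by (intro w2_left_lower) simp
    show "\<forall>\<^sub>F s in at_left y. w1 s + 1 / C * (y - s) \<le> w1 y" if "b1 y < 0"
      using that by (intro w1_left_lower) simp
  qed (use that in auto)
  define X where "X = (x - 1) - C * \<bar>g (x - 1) + B\<bar>"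
  have "X \<le> x - 1" using C_gt_1 by (simp add: X_def)
  have g_le: "g y \<le> - B" if "y < X" for y
  proof -
    have "g y + 1 / C * ((x - 1) - y) \<le> g (x - 1)"
      using that \<open>X \<le> x - 1\<close> by (intro g_growth) auto
    moreover have "1 / C * ((x - 1) - y) \<ge> \<bar>g (x - 1) + B\<bar>"
      using that C_gt_1 by (simp add: X_def field_simps)
    ultimately show ?thesis by linarith
  qed
  \<comment> \<open>Here (p - q)^2 = (p + q)^2 - 4 p q, and the hypothesis bounds - 4 p q below by 4
    B.\<close>
  have gap: "p - q \<ge> 2 * C + L" if "p * q + q\<^sup>2 / 2 \<le> - B" "p > 0" "q < 0" for p q :: real
  proof -
    have "(p - q)\<^sup>2 \<ge> 4 * B"
      using that(1) zero_le_power2[of "p + q"] zero_le_power2[of q]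
      unfolding power2_sum power2_diff by linarith
    moreover have "B \<ge> 0" by (simp add: B_def)
    ultimately have "(2 * C + L)\<^sup>2 \<le> (p - q)\<^sup>2" unfolding B_def by linarith
    then show ?thesis using that by (intro power2_le_imp_le[of "2 * C + L"]) auto
  qed
  have a4: "a1 y - a2 y \<ge> 2 * C + L" if "y < X" "a1 y > 0" "a2 y < 0" for y
    using gap[of "a1 y" "a2 y"] g_le[of y] that eq_right[of y] by (simp add: g_def)
  have a2: "a2 y - a1 y \<ge> 2 * C + L" if "y < X" "a1 y < 0" "a2 y > 0" for y
    using gap[of "a2 y" "a1 y"] g_le[of y] that eq_right[of y] by (simp add: g_def mult.commute)
  \<comment> \<open>At a jump \<open>g y\<close> belongs to the other branch, but by
    \<open>branch_jump_order\<close> the component needed here is not larger, so the bound -B still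
    applies.\<close>
  have b4: "b1 y - b2 y \<ge> 2 * C + L" if "y < X" "b1 y > 0" "b2 y < 0" for y
    using gap[of "b1 y" "b2 y"] g_le[of y] that eq_left[of y] branch_jump_order(1)[of y]
    by (cases "a1 y > 0") (simp_all add: g_def)
  have b2: "b2 y - b1 y \<ge> 2 * C + L" if "y < X" "b1 y < 0" "b2 y > 0" for y
    using gap[of "b2 y" "b1 y"] g_le[of y] that eq_left[of y] branch_jump_order(2)[of y]
    by (cases "a1 y > 0") (simp_all add: g_def mult.commute)
  \<comment> \<open>On either branch the guaranteed rate of \<open>\<psi>\<close> is the gap between
    the derivatives less 2 C, hence at least L. The slope of \<open>h\<close> costs only C; the
    excess gives the strict margin.\<close>
  define \<psi> where "\<psi> y = (if a1 y > 0 then w2 y - w1 y else w1 y - w2 y)" for y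
  have \<psi>_growth: "\<psi> s + L * (t - s) \<le> \<psi> t" if "s \<le> t" "t < X" for s t
    unfolding \<psi>_def
  proof (rule branch_growth)
    show "w1 y < 0 \<or> w2 y < 0" if "y < X" for y
      using region[of y] that \<open>X \<le> x - 1\<close> by simp
  next
    fix y assume y: "y < X" "a1 y > 0" "a2 y < 0"
    have "\<forall>\<^sub>F t in at_right y. w2 y + (- a2 y) * (t - y) \<le> w2 t"
      "\<forall>\<^sub>F t in at_right y. w1 t \<le> w1 y + (2 * C - a1 y) * (t - y)"
      using C_gt_1 by (intro w2_right_lower w1_right_upper; simp)+
    moreover have "\<forall>\<^sub>F t in at_right y. y < t" by (simp add: eventually_at_filter)
    ultimately show "\<forall>\<^sub>F t in at_right y. w2 y - w1 y + L * (t - y) \<le> w2 t - w1 t"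
    proof eventually_elim
      case (elim t)
      have "L * (t - y) \<le> (a1 y - a2 y - 2 * C) * (t - y)"
        using a4[OF y] elim by (intro mult_right_mono) auto
      then show ?case using elim by (simp add: algebra_simps)
    qed
  next
    fix y assume y: "y < X" "a1 y < 0" "a2 y > 0"
    have "\<forall>\<^sub>F t in at_right y. w1 y + (- a1 y) * (t - y) \<le> w1 t"
      "\<forall>\<^sub>F t in at_right y. w2 t \<le> w2 y + (2 * C - a2 y) * (t - y)"
      using C_gt_1 by (intro w1_right_lower w2_right_upper; simp)+
    moreover have "\<forall>\<^sub>F t in at_right y. y < t" by (simp add: eventually_at_filter)
    ultimately show "\<forall>\<^sub>F t in at_right y. w1 y - w2 y + L * (t - y) \<le> w1 t - w2 t"
    proof eventually_elim
      case (elim t)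
      have "L * (t - y) \<le> (a2 y - a1 y - 2 * C) * (t - y)"
        using a2[OF y] elim by (intro mult_right_mono) auto
      then show ?case using elim by (simp add: algebra_simps)
    qed
  next
    fix y assume y: "y < X" "b1 y > 0" "b2 y < 0"
    have "\<forall>\<^sub>F s in at_left y. w2 s + (- b2 y) * (y - s) \<le> w2 y"
      "\<forall>\<^sub>F s in at_left y. w1 y \<le> w1 s + (2 * C - b1 y) * (y - s)"
      using C_gt_1 by (intro w2_left_lower w1_left_upper; simp)+
    moreover have "\<forall>\<^sub>F s in at_left y. s < y" by (simp add: eventually_at_filter)
    ultimately show "\<forall>\<^sub>F s in at_left y. w2 s - w1 s + L * (y - s) \<le> w2 y - w1 y"
    proof eventually_elim
      case (elim s)
      have "L * (y - s) \<le> (b1 y - b2 y - 2 * C) * (y - s)"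
        using b4[OF y] elim by (intro mult_right_mono) auto
      then show ?case using elim by (simp add: algebra_simps)
    qed
  next
    fix y assume y: "y < X" "b1 y < 0" "b2 y > 0"
    have "\<forall>\<^sub>F s in at_left y. w1 s + (- b1 y) * (y - s) \<le> w1 y"
      "\<forall>\<^sub>F s in at_left y. w2 y \<le> w2 s + (2 * C - b2 y) * (y - s)"
      using C_gt_1 by (intro w1_left_lower w2_left_upper; simp)+
    moreover have "\<forall>\<^sub>F s in at_left y. s < y" by (simp add: eventually_at_filter)
    ultimately show "\<forall>\<^sub>F s in at_left y. w1 s - w2 s + L * (y - s) \<le> w1 y - w2 y"
    proof eventually_elim
      case (elim s)
      have "L * (y - s) \<le> (b2 y - b1 y - 2 * C) * (y - s)"
        using b2[OF y] elim by (intro mult_right_mono) auto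
      then show ?case using elim by (simp add: algebra_simps)
    qed
  qed (use that in auto)
  define t where "t = X - 1"
  \<comment> \<open>Growth of \<open>\<psi>\<close> and the bound \<psi> s >= - 2 D (1 - s) are
    incompatible once - s > \<psi> t + 2 D - L t, because L - 2 D = 1.\<close>
  define s where "s = - (\<bar>\<psi> t\<bar> + 2 * D + L * \<bar>t\<bar> + \<bar>t\<bar> + 1)"
  have "L * \<bar>t\<bar> \<ge> 0" using \<open>L > 0\<close> by simp
  then have "s \<le> t" "s \<le> 0" using D_nonneg unfolding s_def by linarith+
  have "\<psi> s + L * (t - s) \<le> \<psi> t" using \<open>s \<le> t\<close> by (intro \<psi>_growth) (simp_all add: t_def)
  moreover have "\<psi> s \<ge> - (2 * (D * (1 - s)))"
    using growth[of s] \<open>s \<le> 0\<close> by (auto simp: \<psi>_def)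
  ultimately have "L * t - s \<le> \<psi> t + 2 * D"
    by (simp add: L_def algebra_simps)
  moreover have "L * t \<ge> - (L * \<bar>t\<bar>)"
    using \<open>L > 0\<close> by (metis abs_ge_minus_self abs_mult abs_of_pos minus_le_iff)
  ultimately show False unfolding s_def by linarith
qed

text \<open>If \<open>b = - a\<close> with both components of \<open>a\<close> positive, then a1 +
  a2 > 0 > b1 + b2, contrary to \<open>jump\<close>.\<close>

lemma derivatives_agree: "b1 x = a1 x" "b2 x = a2 x" and positive: "a1 x > 0" "a2 x > 0"
proof -
  show "a1 x > 0" "a2 x > 0"
    using positive_signs[of x] not_negative[of x] everywhere_positive[of x] by blast+
  then show "b1 x = a1 x" "b2 x = a2 x"
    using left_eq_right[of x] jump[of x] by linarith+
qed

section \<open>A priori bounds independent of the growth constant\<close>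

lemma has_derivative: "(u1 has_real_derivative a1 x) (at x)" "(u2 has_real_derivative a2 x) (at x)"
  using right_deriv[of x] left_deriv[of x] derivatives_agree[of x]
  by (simp_all add: has_field_derivative_iff filterlim_at_split)

text \<open>Above the threshold a1 + a2 >= 4 C + L, while h1 + h2 rises at rate at most 2 C, so w1 +
  w2 falls at rate at least L; the spare 2 C absorbs strictness. Going left, the sum therefore stays
  above the threshold.\<close>

lemma backward_growth:
  assumes "L > 0" "w1 y + w2 y \<ge> (4 * C + L)\<^sup>2" "x \<le> y"
  shows "w1 y + w2 y + L * (y - x) \<le> w1 x + w2 x"
proof -
  define f where "f x = w1 x + w2 x" for x
  have sum_ge: "a1 x + a2 x \<ge> 4 * C + L" if "f x \<ge> (4 * C + L)\<^sup>2" for x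
  proof -
    have "(4 * C + L)\<^sup>2 \<le> (a1 x + a2 x)\<^sup>2"
      using quad_sum_le(1)[of "a1 x" "a2 x"] that positive[of x] eq_right[of x] by (simp add: f_def)
    then show ?thesis using positive[of x] by (intro power2_le_imp_le[of "4 * C + L"]) auto
  qed
  have "f y \<ge> (4 * C + L)\<^sup>2 \<longrightarrow> f y + L * (y - x) \<le> f x"
  proof (rule local_to_global[where P = "\<lambda>s t. f t \<ge> (4 * C + L)\<^sup>2 \<longrightarrow> f t + L * (t - s) \<le> f s",
        OF \<open>x \<le> y\<close>])
    fix r s t
    assume rs: "f s \<ge> (4 * C + L)\<^sup>2 \<longrightarrow> f s + L * (s - r) \<le> f r" and "r \<le> s"
      and st: "f t \<ge> (4 * C + L)\<^sup>2 \<longrightarrow> f t + L * (t - s) \<le> f s" and "s \<le> t"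
    show "f t \<ge> (4 * C + L)\<^sup>2 \<longrightarrow> f t + L * (t - r) \<le> f r"
    proof
      assume t: "f t \<ge> (4 * C + L)\<^sup>2"
      have "L * (t - s) \<ge> 0" using \<open>s \<le> t\<close> \<open>L > 0\<close> by simp
      then have "f s \<ge> (4 * C + L)\<^sup>2" using st t by linarith
      then show "f t + L * (t - r) \<le> f r" using rs st t by (simp add: algebra_simps)
    qed
  next
    fix z
    show "\<forall>\<^sub>F t in at_right z. f t \<ge> (4 * C + L)\<^sup>2 \<longrightarrow> f t + L * (t - z) \<le> f z"
    proof (cases "f z \<ge> (4 * C + L)\<^sup>2")
      case True
      have "\<forall>\<^sub>F t in at_right z. w1 t \<le> w1 z + (2 * C - a1 z) * (t - z)"
        "\<forall>\<^sub>F t in at_right z. w2 t \<le> w2 z + (2 * C - a2 z) * (t - z)"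
        using C_gt_1 by (intro w1_right_upper w2_right_upper; simp)+
      moreover have "\<forall>\<^sub>F t in at_right z. z < t" by (simp add: eventually_at_filter)
      ultimately show ?thesis
      proof eventually_elim
        case (elim t)
        have "L * (t - z) \<le> (a1 z + a2 z - 4 * C) * (t - z)"
          using sum_ge[OF True] elim by (intro mult_right_mono) auto
        then show ?case using elim by (simp add: f_def algebra_simps)
      qed
    next
      case False
      have "(f \<longlongrightarrow> f z) (at_right z)"
        unfolding f_def by (intro tendsto_add w_tendsto)
      then have "\<forall>\<^sub>F t in at_right z. f t < (4 * C + L)\<^sup>2"
        using False by (intro order_tendstoD(2)) auto
      then show ?thesis by eventually_elim simp
    qed
    show "\<forall>\<^sub>F s in at_left z. f z \<ge> (4 * C + L)\<^sup>2 \<longrightarrow> f z + L * (z - s) \<le> f s"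
    proof (cases "f z \<ge> (4 * C + L)\<^sup>2")
      case True
      have "\<forall>\<^sub>F s in at_left z. w1 z \<le> w1 s + (2 * C - a1 z) * (z - s)"
        "\<forall>\<^sub>F s in at_left z. w2 z \<le> w2 s + (2 * C - a2 z) * (z - s)"
        using C_gt_1 derivatives_agree[of z] by (intro w1_left_upper w2_left_upper; simp)+
      moreover have "\<forall>\<^sub>F s in at_left z. s < z" by (simp add: eventually_at_filter)
      ultimately show ?thesis
      proof eventually_elim
        case (elim s)
        have "L * (z - s) \<le> (a1 z + a2 z - 4 * C) * (z - s)"
          using sum_ge[OF True] elim by (intro mult_right_mono) auto
        then show ?case using elim by (simp add: f_def algebra_simps)
      qed
    qed simp
  qed simp
  then show ?thesis using assms by (simp add: f_def)
qed

text \<open>A bootstrap on \<open>backward_growth\<close>: the rate 1 carries w1 + w2, going left,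
  past the threshold for the rate 2 D + 1, and that rate violates \<open>growth\<close>.\<close>

lemma w_sum_bound: "w1 x + w2 x < (4 * C + 1)\<^sup>2"
proof (rule ccontr)
  assume "\<not> w1 x + w2 x < (4 * C + 1)\<^sup>2"
  then have slow: "w1 x + w2 x + 1 * (x - y) \<le> w1 y + w2 y" if "y \<le> x" for y
    using that by (intro backward_growth) auto
  define L where "L = 2 * D + 1"
  have "L > 0" using D_nonneg by (simp add: L_def)
  define y where "y = x - (4 * C + L)\<^sup>2"
  have "y \<le> x" by (simp add: y_def)
  have "w1 y + w2 y \<ge> (4 * C + L)\<^sup>2"
    using slow[OF \<open>y \<le> x\<close>] everywhere_positive[of x] by (simp add: y_def)
  then have fast: "w1 y + w2 y + L * (y - z) \<le> w1 z + w2 z" if "z \<le> y" for z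
    using that \<open>L > 0\<close> by (intro backward_growth) auto
  define z where "z = - (\<bar>y\<bar> + 2 * D + L * \<bar>y\<bar> + 1)"
  have "L * \<bar>y\<bar> \<ge> 0" using \<open>L > 0\<close> by simp
  then have "z \<le> y" "z \<le> 0" using D_nonneg unfolding z_def by linarith+
  have "w1 z + w2 z \<le> 2 * (D * (1 - z))"
    using growth[of z] \<open>z \<le> 0\<close> by auto
  then have "L * (y - z) \<le> 2 * (D * (1 - z))"
    using fast[OF \<open>z \<le> y\<close>] everywhere_positive[of y] by linarith
  then have "L * y - z \<le> 2 * D" by (simp add: L_def algebra_simps)
  moreover have "L * y \<ge> - (L * \<bar>y\<bar>)"
    using \<open>L > 0\<close> by (metis abs_ge_minus_self abs_mult abs_of_pos minus_le_iff)
  ultimately show False unfolding z_def by linarith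
qed

lemma derivative_sum_bound: "a1 x + a2 x \<le> 2 * (4 * C + 1)"
proof -
  have "(a1 x + a2 x)\<^sup>2 \<le> 2 * (w1 x + w2 x)"
    using quad_sum_le(2)[of "a1 x" "a2 x"] positive[of x] eq_right[of x] by simp
  also have "\<dots> \<le> (2 * (4 * C + 1))\<^sup>2"
    using w_sum_bound[of x] everywhere_positive[of x] unfolding power_mult_distrib by simp
  finally show ?thesis using C_gt_1 by (intro power2_le_imp_le[of "a1 x + a2 x"]) auto
qed

end

subsection \<open>Uniqueness\<close>

text \<open>The squared distance \<open>V\<close> satisfies V' <= - V / (4 M): the increment of the
  quadratic map is minus the difference of the solutions, so strong monotonicity bounds V' by - S Q,
  and the Lipschitz estimate bounds V by 4 S^2 Q. The resulting growth to the left contradicts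
  \<open>w_sum_bound\<close>.\<close>

lemma one_sided_solution_unique:
  assumes "one_sided_solution C D h1 h2 u1 u2 a1 a2 b1 b2"
    and "one_sided_solution C D' h1 h2 u1' u2' a1' a2' b1' b2'"
  shows "u1 x = u1' x \<and> u2 x = u2' x"
proof (rule ccontr)
  assume neq: "\<not> (u1 x = u1' x \<and> u2 x = u2' x)"
  interpret u: one_sided_solution C D h1 h2 u1 u2 a1 a2 b1 b2 by fact
  interpret u': one_sided_solution C D' h1 h2 u1' u2' a1' a2' b1' b2' by fact
  define v1 v2 V where "v1 y = u1 y - u1' y" and "v2 y = u2 y - u2' y"
    and "V y = (v1 y)\<^sup>2 + (v2 y)\<^sup>2" for y
  define M where "M = 2 * (4 * C + 1)"
  have "M > 0" using u.C_gt_1 by (simp add: M_def)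
  have decay: "\<exists>V'. (V has_real_derivative V') (at y) \<and> V' \<le> - (V y / (4 * M))" for y
  proof (intro exI conjI)
    let ?V' = "2 * (v1 y * (a1 y - a1' y) + v2 y * (a2 y - a2' y))"
    show "(V has_real_derivative ?V') (at y)"
      unfolding V_def v1_def v2_def
      by (auto intro!: derivative_eq_intros u.has_derivative u'.has_derivative)
    define S where "S = (a1 y + a2 y + a1' y + a2' y) / 2"
    define Q where "Q = (a1 y - a1' y)\<^sup>2 + (a2 y - a2' y)\<^sup>2"
    have "S > 0" using u.positive[of y] u'.positive[of y] by (simp add: S_def)
    have "S \<le> M"
      using u.derivative_sum_bound[of y] u'.derivative_sum_bound[of y] by (simp add: S_def M_def)
    have w: "(a1 y * a2 y + (a1 y)\<^sup>2 / 2) - (a1' y * a2' y + (a1' y)\<^sup>2 / 2) = - v1 y"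
      "(a1 y * a2 y + (a2 y)\<^sup>2 / 2) - (a1' y * a2' y + (a2' y)\<^sup>2 / 2) = - v2 y"
      using u.eq_right[of y] u'.eq_right[of y] by (simp_all add: v1_def v2_def)
    have mono: "S * Q \<le> - ?V'"
      using quad_strongly_monotone[OF u.positive[of y] u'.positive[of y]]
      unfolding w S_def[symmetric] Q_def[symmetric] by (simp add: algebra_simps)
    have "V y \<le> 4 * S\<^sup>2 * Q"
      using quad_lipschitz[OF u.positive[of y] u'.positive[of y]]
      unfolding w S_def[symmetric] Q_def[symmetric] by (simp add: V_def)
    then have "V y / (4 * S) \<le> S * Q"
      using \<open>S > 0\<close> by (simp add: field_simps power2_eq_square)
    moreover have "V y / (4 * M) \<le> V y / (4 * S)"
      using \<open>S > 0\<close> \<open>S \<le> M\<close> by (intro divide_left_mono) (auto simp: V_def)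
    ultimately show "?V' \<le> - (V y / (4 * M))" using mono by linarith
  qed
  have V_nonneg: "V y \<ge> 0" for y by (simp add: V_def)
  have "V x > 0"
    using neq by (auto simp: V_def v1_def v2_def sum_power2_gt_zero_iff)
  have mono: "V y \<ge> V x" if "y \<le> x" for y
  proof (rule DERIV_nonpos_imp_nonincreasing[OF that])
    fix z
    show "\<exists>V'. (V has_real_derivative V') (at z) \<and> V' \<le> 0"
      using decay[of z] V_nonneg[of z] \<open>M > 0\<close> by (meson divide_nonneg_pos mult_pos_pos neg_le_0_iff_le order_trans zero_less_numeral)
  qed
  \<comment> \<open>Left of \<open>x\<close> the value of \<open>V\<close> is at least
    \<open>V x\<close>, so \<open>V\<close> increases to the left at rate at least \<open>k\<close>;
    linear growth already contradicts boundedness.\<close>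
  define k where "k = V x / (4 * M)"
  have "k > 0" using \<open>V x > 0\<close> \<open>M > 0\<close> by (simp add: k_def)
  have grow: "V y + k * y \<ge> V x + k * x" if "y \<le> x" for y
  proof (rule DERIV_nonpos_imp_nonincreasing[OF that])
    fix z assume "z \<le> x"
    obtain V' where V': "(V has_real_derivative V') (at z)" "V' \<le> - (V z / (4 * M))"
      using decay by blast
    have "k \<le> V z / (4 * M)"
      unfolding k_def using mono[OF \<open>z \<le> x\<close>] \<open>M > 0\<close> by (intro divide_right_mono) auto
    then show "\<exists>d. ((\<lambda>y. V y + k * y) has_real_derivative d) (at z) \<and> d \<le> 0"
      using V' by (intro exI[of _ "V' + k"]) (auto intro!: derivative_eq_intros)
  qed
  define B where "B = (4 * C + 1)\<^sup>2"
  have bounded: "V y \<le> B\<^sup>2 + B\<^sup>2" for y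
  proof -
    have "\<bar>v1 y\<bar> \<le> B" "\<bar>v2 y\<bar> \<le> B"
      using u.everywhere_positive[of y] u'.everywhere_positive[of y]
        u.w_sum_bound[of y] u'.w_sum_bound[of y]
      unfolding B_def v1_def v2_def by linarith+
    then show ?thesis unfolding V_def by (intro add_mono) (metis abs_le_square_iff abs_of_nonneg abs_ge_zero order_trans)+
  qed
  define y where "y = x - (B\<^sup>2 + B\<^sup>2) / k"
  have "y \<le> x" using \<open>k > 0\<close> by (simp add: y_def)
  then have "V x + (B\<^sup>2 + B\<^sup>2) \<le> V y"
    using grow[of y] \<open>k > 0\<close> by (simp add: y_def algebra_simps)
  then show False using bounded[of y] \<open>V x > 0\<close> by linarith
qed

subsection \<open>One-sided derivatives of absolutely continuous functions\<close>

text \<open>A mean value inequality with a null exceptional set, by a gauge. Intervals tagged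
  outside \<open>N\<close> are short enough for differentiability at the tag; those tagged in
  \<open>N\<close> lie in an open set of small measure, where absolute continuity makes the total
  increment small.\<close>

lemma abs_continuous_on_slope_bound:
  fixes f :: "real \<Rightarrow> 'a::real_normed_vector"
  assumes ac: "abs_continuous_on {a..b} f" and "a \<le> b" and N: "negligible N" and "0 \<le> e"
    and der: "\<And>x. x \<in> {a..b} - N \<Longrightarrow> \<exists>D. (f has_vector_derivative D) (at x) \<and> norm (D - p) \<le> e"
  shows "norm (f b - f a - (b - a) *\<^sub>R p) \<le> e * (b - a)"
proof -
  have main: "norm (f b - f a - (b - a) *\<^sub>R p) \<le> e * (b - a) + \<eta> * (b - a + 1 + norm p)"
    if "\<eta> > 0" for \<eta> :: real
  proof -
    obtain \<delta>0 where "\<delta>0 > 0" and \<delta>0: "\<And>\<D> T. \<D> division_of T \<Longrightarrow> T \<subseteq> {a..b} \<Longrightarrow>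
        (\<Sum>K\<in>\<D>. Sup K - Inf K) < \<delta>0 \<Longrightarrow> (\<Sum>K\<in>\<D>. norm (f (Sup K) - f (Inf K))) < \<eta>"
      using ac \<open>\<eta> > 0\<close> unfolding abs_continuous_on_def by meson
    \<comment> \<open>The bound by \<open>\<eta>\<close> serves the term \<open>norm p\<close> times
      the total length of the intervals tagged in \<open>N\<close>.\<close>
    define \<delta> where "\<delta> = min \<delta>0 \<eta>"
    have "\<delta> > 0" using \<open>\<delta>0 > 0\<close> \<open>\<eta> > 0\<close> by (simp add: \<delta>_def)
    have Nsets: "N \<in> sets lebesgue" using N negligible_imp_sets by blast
    obtain U where U: "open U" "N \<subseteq> U" "U - N \<in> lmeasurable" "emeasure lebesgue (U - N) < ennreal \<delta>"
      using sets_lebesgue_outer_open[OF Nsets \<open>\<delta> > 0\<close>] by blast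
    have Ueq: "U = (U - N) \<union> N" using U(2) by blast
    have Ulm: "U \<in> lmeasurable"
      using U(3) N Ueq by (metis fmeasurable.Un negligible_imp_measurable)
    have "measure lebesgue (U - N) < \<delta>"
      using U(3,4) \<open>\<delta> > 0\<close> by (metis emeasure_eq_measure2 ennreal_leI linorder_not_le)
    moreover have "measure lebesgue U \<le> measure lebesgue (U - N) + measure lebesgue N"
      using measure_Un_le[of "U - N" lebesgue N] Ueq U(3) Nsets by (metis fmeasurableD)
    ultimately have Um: "measure lebesgue U < \<delta>"
      using N by (simp add: negligible_imp_measure0)
    have "\<exists>d>0. x \<in> {a..b} - N \<longrightarrow> (\<forall>u v. u \<le> x \<and> x \<le> v \<and> {u..v} \<subseteq> ball x d \<longrightarrow>
            norm (f v - f u - (v - u) *\<^sub>R p) \<le> (e + \<eta>) * (v - u))" for x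
    proof (cases "x \<in> {a..b} - N")
      case True
      then obtain D where D: "(f has_vector_derivative D) (at x)" "norm (D - p) \<le> e"
        using der by blast
      obtain d where d: "d > 0" "\<And>y. norm (y - x) < d \<Longrightarrow>
          norm (f y - f x - (y - x) *\<^sub>R D) \<le> \<eta> * norm (y - x)"
        using D(1) \<open>\<eta> > 0\<close> unfolding has_vector_derivative_def has_derivative_at_alt by meson
      have "norm (f v - f u - (v - u) *\<^sub>R p) \<le> (e + \<eta>) * (v - u)"
        if "u \<le> x" "x \<le> v" "{u..v} \<subseteq> ball x d" for u v
      proof -
        have "u \<in> ball x d" "v \<in> ball x d"
          using that(1,2) by (auto intro!: subsetD[OF that(3)] simp del: mem_ball)
        then have 1: "norm (f u - f x - (u - x) *\<^sub>R D) \<le> \<eta> * (x - u)"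
          and 2: "norm (f v - f x - (v - x) *\<^sub>R D) \<le> \<eta> * (v - x)"
          using d(2)[of u] d(2)[of v] that by (auto simp: dist_real_def)
        have "f v - f u - (v - u) *\<^sub>R p = (f v - f x - (v - x) *\<^sub>R D) - (f u - f x - (u - x) *\<^sub>R D)
            + (v - u) *\<^sub>R (D - p)"
          by (simp add: algebra_simps)
        also have "norm \<dots> \<le> norm (f v - f x - (v - x) *\<^sub>R D) + norm (f u - f x - (u - x) *\<^sub>R D)
            + norm ((v - u) *\<^sub>R (D - p))"
          by (meson norm_triangle_ineq norm_triangle_ineq4 order_trans add_right_mono)
        also have "norm ((v - u) *\<^sub>R (D - p)) \<le> (v - u) * e"
          using D(2) that by (simp add: mult_left_mono)
        finally show ?thesis using 1 2 by (simp add: algebra_simps)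
      qed
      then show ?thesis using d(1) by blast
    qed (auto intro: exI[of _ 1])
    then obtain d where dpos: "\<And>x. d x > 0" and d: "\<And>x u v. x \<in> {a..b} - N \<Longrightarrow> u \<le> x \<Longrightarrow> x \<le> v
        \<Longrightarrow> {u..v} \<subseteq> ball x (d x) \<Longrightarrow> norm (f v - f u - (v - u) *\<^sub>R p) \<le> (e + \<eta>) * (v - u)"
      by metis
    define \<gamma> where "\<gamma> x = (if x \<in> N then U else ball x (d x))" for x
    have "gauge \<gamma>"
      using U(1,2) dpos by (auto simp: gauge_def \<gamma>_def)
    then obtain \<P> where \<P>: "\<P> tagged_division_of {a..b}" "\<gamma> fine \<P>"
      using fine_division_exists_real by blast
    have fin: "finite \<P>" using \<P>(1) by blast
    define \<N> where "\<N> = {(x,K) \<in> \<P>. x \<in> N}"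
    have sub: "\<N> \<subseteq> \<P>" by (auto simp: \<N>_def)
    have tdN: "\<N> tagged_division_of (\<Union>(snd ` \<N>))"
      using \<P>(1) sub by (meson tagged_division_of_def tagged_partial_division_of_Union_self
          tagged_partial_division_subset)
    have divN: "(snd ` \<N>) division_of (\<Union>(snd ` \<N>))"
      using tdN by (rule division_of_tagged_division)
    have Kform: "\<exists>u v. K = {u..v} \<and> u \<le> x \<and> x \<le> v" if "(x,K) \<in> \<P>" for x K
      using tagged_division_ofD(2,4)[OF \<P>(1) that] by (metis atLeastAtMost_iff interval_cbox)
    \<comment> \<open>Different tags may share a degenerate interval, so passing to the set of
      intervals requires \<open>g\<close> to vanish on singletons. \<open>?g\<close> is 0 on the
      empty set, where \<open>Sup\<close> and \<open>Inf\<close> carry no information; no interval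
      of the division is empty.\<close>
    have reindex: "(\<Sum>(x,K)\<in>\<N>. g K) = (\<Sum>K\<in>snd ` \<N>. g K)"
      if g: "\<And>u. g {u} = (0::real)" for g
    proof -
      let ?g = "\<lambda>K. if K = {} then 0 else g K"
      have "(\<Sum>(x,K)\<in>\<N>. g K) = (\<Sum>(x,K)\<in>\<N>. ?g K)"
        using Kform sub by (intro sum.cong) fastforce+
      also have "\<dots> = (\<Sum>K\<in>snd ` \<N>. ?g K)"
      proof (rule sum.over_tagged_division_lemma[OF tdN])
        show "?g (cbox u v) = 0" if "box u v = {}" for u v
          using that g by (cases "u = v") (auto simp: box_real)
      qed
      also have "\<dots> = (\<Sum>K\<in>snd ` \<N>. g K)"
        using Kform sub by (intro sum.cong) fastforce+
      finally show ?thesis .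
    qed
    have len: "(\<Sum>K\<in>snd ` \<N>. Sup K - Inf K) < \<delta>"
    proof -
      have "(\<Sum>K\<in>snd ` \<N>. Sup K - Inf K) = (\<Sum>K\<in>snd ` \<N>. measure lebesgue K)"
        using Kform sub by (intro sum.cong) fastforce+
      also have "\<dots> = measure lebesgue (\<Union>(snd ` \<N>))"
        by (rule content_division[OF divN])
      also have "\<dots> \<le> measure lebesgue U"
      proof (rule measure_mono_fmeasurable[OF _ _ Ulm])
        show "\<Union>(snd ` \<N>) \<subseteq> U"
          using \<P>(2) by (fastforce simp: fine_def \<gamma>_def \<N>_def split: if_splits)
        show "\<Union>(snd ` \<N>) \<in> sets lebesgue"
          using lmeasurable_division[OF divN] by blast
      qed
      finally show ?thesis using Um by linarith
    qed
    have "\<Union>(snd ` \<N>) \<subseteq> {a..b}"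
      using \<P>(1) sub by (fastforce dest: tagged_division_ofD(3))
    then have var: "(\<Sum>K\<in>snd ` \<N>. norm (f (Sup K) - f (Inf K))) < \<eta>"
      using \<delta>0[OF divN] len by (simp add: \<delta>_def)
    have "(\<Sum>(x,K)\<in>\<P>. f (Sup K) - f (Inf K)) = f b - f a"
      by (rule additive_tagged_division_1[OF \<open>a \<le> b\<close> \<P>(1)])
    moreover have total: "(\<Sum>(x,K)\<in>\<P>. Sup K - Inf K) = b - a"
      using additive_tagged_division_1[OF \<open>a \<le> b\<close> \<P>(1), of "\<lambda>x. x"] by simp
    ultimately have "f b - f a - (b - a) *\<^sub>R p
        = (\<Sum>(x,K)\<in>\<P>. f (Sup K) - f (Inf K) - (Sup K - Inf K) *\<^sub>R p)"
      by (simp add: sum_subtractf scaleR_left.sum case_prod_unfold flip: scaleR_sum_left)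
    also have "norm \<dots> \<le> (\<Sum>(x,K)\<in>\<P>. norm (f (Sup K) - f (Inf K) - (Sup K - Inf K) *\<^sub>R p))"
      by (simp add: case_prod_unfold norm_sum)
    also have "\<dots> \<le> (\<Sum>(x,K)\<in>\<P>. (e + \<eta>) * (Sup K - Inf K) + (if x \<in> N then
          norm (f (Sup K) - f (Inf K)) + norm p * (Sup K - Inf K) else 0))"
    proof (rule sum_mono, clarify)
      fix x K assume xK: "(x,K) \<in> \<P>"
      then obtain u v where K: "K = {u..v}" "u \<le> x" "x \<le> v" using Kform by blast
      show "norm (f (Sup K) - f (Inf K) - (Sup K - Inf K) *\<^sub>R p) \<le> (e + \<eta>) * (Sup K - Inf K) +
          (if x \<in> N then norm (f (Sup K) - f (Inf K)) + norm p * (Sup K - Inf K) else 0)"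
      proof (cases "x \<in> N")
        case True
        have "norm (f v - f u - (v - u) *\<^sub>R p) \<le> norm (f v - f u) + norm p * (v - u)"
          using norm_triangle_ineq4[of "f v - f u" "(v - u) *\<^sub>R p"] K by (simp add: mult.commute)
        moreover have "0 \<le> (e + \<eta>) * (v - u)" using K \<open>0 \<le> e\<close> \<open>\<eta> > 0\<close> by simp
        ultimately show ?thesis using True K by simp
      next
        case False
        have "x \<in> {a..b}" using tagged_division_ofD(2,3)[OF \<P>(1) xK] by blast
        moreover have "{u..v} \<subseteq> ball x (d x)"
          using \<P>(2) xK False K by (fastforce simp: fine_def \<gamma>_def)
        ultimately show ?thesis using d[of x u v] K False by simp
      qed
    qed
    also have "\<dots> = (e + \<eta>) * (\<Sum>(x,K)\<in>\<P>. Sup K - Inf K) + (\<Sum>(x,K)\<in>\<N>.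
          norm (f (Sup K) - f (Inf K)) + norm p * (Sup K - Inf K))"
    proof -
      have "(\<Sum>(x,K)\<in>\<P>. if x \<in> N then norm (f (Sup K) - f (Inf K)) + norm p * (Sup K - Inf K) else 0)
          = (\<Sum>(x,K)\<in>\<N>. norm (f (Sup K) - f (Inf K)) + norm p * (Sup K - Inf K))"
        unfolding \<N>_def by (rule sum.mono_neutral_cong_right) (auto simp: fin split: if_splits)
      then show ?thesis
        by (simp add: sum.distrib case_prod_unfold sum_distrib_left)
    qed
    also have "\<dots> = (e + \<eta>) * (b - a) + ((\<Sum>K\<in>snd ` \<N>. norm (f (Sup K) - f (Inf K)))
          + norm p * (\<Sum>K\<in>snd ` \<N>. Sup K - Inf K))"
      using reindex[of "\<lambda>K. norm (f (Sup K) - f (Inf K)) + norm p * (Sup K - Inf K)"] total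
      by (simp add: sum.distrib sum_distrib_left)
    also have "\<dots> \<le> (e + \<eta>) * (b - a) + (\<eta> + norm p * \<eta>)"
      using var len \<open>0 \<le> e\<close> \<open>\<eta> > 0\<close> by (intro add_mono mult_left_mono) (auto simp: \<delta>_def)
    finally show ?thesis by (simp add: algebra_simps)
  qed
  let ?A = "b - a + 1 + norm p"
  have "?A > 0" using \<open>a \<le> b\<close> by (simp add: add_pos_nonneg)
  show ?thesis
  proof (rule field_le_epsilon)
    fix t :: real assume "t > 0"
    with main[of "t / ?A"] \<open>?A > 0\<close> show "norm (f b - f a - (b - a) *\<^sub>R p) \<le> e * (b - a) + t"
      by simp
  qed
qed

text \<open>Nonempty open intervals are not null, so they meet the complement of \<open>N\<close>.
  This makes one-sided limits taken off \<open>N\<close> unique.\<close>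

lemma at_within_Diff_negligible_nontrivial:
  fixes y :: real
  assumes "negligible N"
  shows "at y within ({y<..} - N) \<noteq> bot" "at y within ({..<y} - N) \<noteq> bot"
proof -
  have *: "\<exists>x\<in>{c<..<d} - N. True" if "c < d" for c d
  proof (rule ccontr)
    assume "\<not> ?thesis"
    then have "{c<..<d} \<subseteq> N" by blast
    then have "negligible {c<..<d}" using assms negligible_subset by blast
    then show False using that open_not_negligible[of "{c<..<d}"] by auto
  qed
  have "y islimpt ({y<..} - N)" "y islimpt ({..<y} - N)"
    unfolding islimpt_approachable
  proof safe
    fix e :: real assume "e > 0"
    then obtain x z where "x \<in> {y<..<y+e} - N" "z \<in> {y-e<..<y} - N"
      using *[of y "y + e"] *[of "y - e" y] by auto
    then have "x \<in> {y<..} - N \<and> x \<noteq> y \<and> dist x y < e" "z \<in> {..<y} - N \<and> z \<noteq> y \<and> dist z y < e"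
      by (auto simp: dist_real_def)
    then show "\<exists>x'\<in>{y<..} - N. x' \<noteq> y \<and> dist x' y < e" "\<exists>x'\<in>{..<y} - N. x' \<noteq> y \<and> dist x' y < e"
      by blast+
  qed
  then show "at y within ({y<..} - N) \<noteq> bot" "at y within ({..<y} - N) \<noteq> bot"
    by (simp_all add: trivial_limit_within)
qed

section \<open>One-sided derivatives from one-sided limits of the almost-everywhere
  derivative\<close>

context
  fixes f f' :: "real \<Rightarrow> 'a::real_normed_vector" and N :: "real set"
  assumes ac: "\<And>a b. abs_continuous_on {a..b} f" and N: "negligible N"
    and deriv: "\<And>x. x \<notin> N \<Longrightarrow> (f has_vector_derivative f' x) (at x)"
begin

lemma slope_near_right:
  assumes "(f' \<longlongrightarrow> p) (at y within {y<..} - N)" "e > 0"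
  shows "\<exists>d>0. \<forall>s t. y \<le> s \<and> s \<le> t \<and> t < y + d \<longrightarrow> norm (f t - f s - (t - s) *\<^sub>R p) \<le> e * (t - s)"
proof -
  obtain d where d: "d > 0" "\<forall>x\<in>{y<..} - N. x \<noteq> y \<and> dist x y < d \<longrightarrow> dist (f' x) p < e"
    using tendstoD[OF assms] unfolding eventually_at by blast
  have "norm (f t - f s - (t - s) *\<^sub>R p) \<le> e * (t - s)" if "y \<le> s" "s \<le> t" "t < y + d" for s t
  proof (rule abs_continuous_on_slope_bound[OF ac \<open>s \<le> t\<close>])
    \<comment> \<open>The limit says nothing about the derivative at \<open>y\<close> itself, so
      \<open>y\<close> joins the exceptional set.\<close>
    show "negligible (insert y N)" using N by simp
    fix x assume "x \<in> {s..t} - insert y N"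
    then have "norm (f' x - p) \<le> e" "(f has_vector_derivative f' x) (at x)"
      using d(2)[rule_format, of x] deriv[of x] that by (auto simp: dist_norm less_imp_le)
    then show "\<exists>D. (f has_vector_derivative D) (at x) \<and> norm (D - p) \<le> e" by blast
  qed (use \<open>e > 0\<close> in simp)
  then show ?thesis using d(1) by blast
qed

lemma slope_near_left:
  assumes "(f' \<longlongrightarrow> p) (at y within {..<y} - N)" "e > 0"
  shows "\<exists>d>0. \<forall>s t. y - d < s \<and> s \<le> t \<and> t \<le> y \<longrightarrow> norm (f t - f s - (t - s) *\<^sub>R p) \<le> e * (t - s)"
proof -
  obtain d where d: "d > 0" "\<forall>x\<in>{..<y} - N. x \<noteq> y \<and> dist x y < d \<longrightarrow> dist (f' x) p < e"
    using tendstoD[OF assms] unfolding eventually_at by blast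
  have "norm (f t - f s - (t - s) *\<^sub>R p) \<le> e * (t - s)" if "y - d < s" "s \<le> t" "t \<le> y" for s t
  proof (rule abs_continuous_on_slope_bound[OF ac \<open>s \<le> t\<close>])
    show "negligible (insert y N)" using N by simp
    fix x assume "x \<in> {s..t} - insert y N"
    then have "norm (f' x - p) \<le> e" "(f has_vector_derivative f' x) (at x)"
      using d(2)[rule_format, of x] deriv[of x] that by (auto simp: dist_norm less_imp_le)
    then show "\<exists>D. (f has_vector_derivative D) (at x) \<and> norm (D - p) \<le> e" by blast
  qed (use \<open>e > 0\<close> in simp)
  then show ?thesis using d(1) by blast
qed

lemma right_vector_derivative:
  assumes "(f' \<longlongrightarrow> p) (at y within {y<..} - N)"
  shows "(f has_vector_derivative p) (at_right y)"
  unfolding has_vector_derivative_def has_derivative_within_alt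
proof (intro conjI allI impI)
  fix e :: real assume "e > 0"
  then obtain d where "d > 0" and d: "\<forall>s t. y \<le> s \<and> s \<le> t \<and> t < y + d \<longrightarrow>
      norm (f t - f s - (t - s) *\<^sub>R p) \<le> e * (t - s)"
    using slope_near_right[OF assms, of e] by blast
  show "\<exists>d>0. \<forall>t\<in>{y<..}. norm (t - y) < d \<longrightarrow> norm (f t - f y - (t - y) *\<^sub>R p) \<le> e * norm (t - y)"
    using \<open>d > 0\<close> d[rule_format, of y] by (intro exI[of _ d]) auto
qed (rule bounded_linear_scaleR_left)

lemma left_vector_derivative:
  assumes "(f' \<longlongrightarrow> p) (at y within {..<y} - N)"
  shows "(f has_vector_derivative p) (at_left y)"
  unfolding has_vector_derivative_def has_derivative_within_alt
proof (intro conjI allI impI)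
  fix e :: real assume "e > 0"
  then obtain d where "d > 0" and d: "\<forall>s t. y - d < s \<and> s \<le> t \<and> t \<le> y \<longrightarrow>
      norm (f t - f s - (t - s) *\<^sub>R p) \<le> e * (t - s)"
    using slope_near_left[OF assms, of e] by blast
  show "\<exists>d>0. \<forall>t\<in>{..<y}. norm (t - y) < d \<longrightarrow> norm (f t - f y - (t - y) *\<^sub>R p) \<le> e * norm (t - y)"
  proof (intro exI[of _ d] conjI ballI impI)
    fix t assume t: "t \<in> {..<y}" "norm (t - y) < d"
    have "f t - f y - (t - y) *\<^sub>R p = - (f y - f t - (y - t) *\<^sub>R p)"
      by (simp add: algebra_simps)
    then show "norm (f t - f y - (t - y) *\<^sub>R p) \<le> e * norm (t - y)"
      using d[rule_format, of t y] t by (simp only: norm_minus_cancel) auto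
  qed fact
qed (rule bounded_linear_scaleR_left)

lemma right_derivative_near:
  assumes r: "(f has_vector_derivative r) (at_right t)" and "t < z"
    and slope: "\<And>s. t \<le> s \<Longrightarrow> s < z \<Longrightarrow> norm (f s - f t - (s - t) *\<^sub>R p) \<le> e * (s - t)"
  shows "norm (r - p) \<le> e"
proof (rule field_le_epsilon)
  fix \<eta> :: real assume "\<eta> > 0"
  then obtain d where d: "d > 0" "\<And>s. s \<in> {t<..} \<Longrightarrow> norm (s - t) < d \<Longrightarrow>
      norm (f s - f t - (s - t) *\<^sub>R r) \<le> \<eta> * norm (s - t)"
    using r unfolding has_vector_derivative_def has_derivative_within_alt by meson
  obtain \<tau> where "0 < \<tau>" "\<tau> < min d (z - t)"
    using dense[of 0 "min d (z - t)"] \<open>d > 0\<close> \<open>t < z\<close> by auto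
  then have \<tau>: "\<tau> > 0" "\<tau> < d" "t + \<tau> < z" by simp_all
  have "\<tau> *\<^sub>R (r - p) = (f (t + \<tau>) - f t - \<tau> *\<^sub>R p) - (f (t + \<tau>) - f t - \<tau> *\<^sub>R r)"
    by (simp add: algebra_simps)
  then have "norm (\<tau> *\<^sub>R (r - p)) \<le> norm (f (t + \<tau>) - f t - \<tau> *\<^sub>R p) + norm (f (t + \<tau>) - f t - \<tau> *\<^sub>R r)"
    by (metis norm_triangle_ineq4)
  also have "\<dots> \<le> e * \<tau> + \<eta> * \<tau>"
    using slope[of "t + \<tau>"] d(2)[of "t + \<tau>"] \<tau> by auto
  finally have "\<tau> * norm (r - p) \<le> \<tau> * (e + \<eta>)"
    using \<tau> by (simp add: mult.commute distrib_left)
  then show "norm (r - p) \<le> e + \<eta>" using \<tau> by (simp add: mult_le_cancel_left_pos)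
qed

text \<open>Near \<open>y\<close>, on the side considered, difference quotients are within e/2 of
  \<open>q\<close>, hence so are the right derivatives. The second claim supplies the left limits of
  right derivatives that \<open>one_sided_solution\<close> asks for.\<close>

lemma right_derivatives_tendsto:
  assumes p: "\<And>t. (f has_vector_derivative p t) (at_right t)"
  shows "(f' \<longlongrightarrow> q) (at y within {y<..} - N) \<Longrightarrow> (p \<longlongrightarrow> q) (at_right y)"
    and "(f' \<longlongrightarrow> q) (at y within {..<y} - N) \<Longrightarrow> (p \<longlongrightarrow> q) (at_left y)"
proof -
  show "(p \<longlongrightarrow> q) (at_right y)" if lim: "(f' \<longlongrightarrow> q) (at y within {y<..} - N)"
  proof (rule tendstoI)
    fix e :: real assume "e > 0"
    then obtain d where "d > 0" and d: "\<forall>s t. y \<le> s \<and> s \<le> t \<and> t < y + d \<longrightarrow>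
        norm (f t - f s - (t - s) *\<^sub>R q) \<le> e / 2 * (t - s)"
      using slope_near_right[OF lim, of "e / 2"] by fastforce
    have "dist (p t) q < e" if "y < t" "t < y + d" for t
      using right_derivative_near[OF p[of t], of "y + d" q "e / 2"] d[rule_format, of t] that \<open>e > 0\<close>
      by (simp add: dist_norm)
    then show "\<forall>\<^sub>F t in at_right y. dist (p t) q < e"
      unfolding eventually_at_right_field using \<open>d > 0\<close> by (intro exI[of _ "y + d"]) auto
  qed
  show "(p \<longlongrightarrow> q) (at_left y)" if lim: "(f' \<longlongrightarrow> q) (at y within {..<y} - N)"
  proof (rule tendstoI)
    fix e :: real assume "e > 0"
    then obtain d where "d > 0" and d: "\<forall>s t. y - d < s \<and> s \<le> t \<and> t \<le> y \<longrightarrow>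
        norm (f t - f s - (t - s) *\<^sub>R q) \<le> e / 2 * (t - s)"
      using slope_near_left[OF lim, of "e / 2"] by fastforce
    have "dist (p t) q < e" if "y - d < t" "t < y" for t
      using right_derivative_near[OF p[of t], of y q "e / 2"] d[rule_format, of t] that \<open>e > 0\<close>
      by (simp add: dist_norm)
    then show "\<forall>\<^sub>F t in at_left y. dist (p t) q < e"
      unfolding eventually_at_left_field using \<open>d > 0\<close> by (intro exI[of _ "y - d"]) auto
  qed
qed

end

lemma admissible_solution_one_sided:
  fixes u :: "real \<Rightarrow> real ^ 2"
  assumes adm: "admissible_solution h1 h2 u" and "C > 1"
    and h1: "\<And>x y. x \<le> y \<Longrightarrow> (y - x) / C \<le> h1 y - h1 x" "\<And>x y. x \<le> y \<Longrightarrow> h1 y - h1 x \<le> C * (y - x)"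
    and h2: "\<And>x y. x \<le> y \<Longrightarrow> (y - x) / C \<le> h2 y - h2 x" "\<And>x y. x \<le> y \<Longrightarrow> h2 y - h2 x \<le> C * (y - x)"
  shows "\<exists>D a1 a2 b1 b2. one_sided_solution C D h1 h2 (\<lambda>x. u x $ 1) (\<lambda>x. u x $ 2) a1 a2 b1 b2"
proof -
  define u' where "u' x = vector_derivative u (at x)" for x
  have ac: "\<And>a b. abs_continuous_on {a..b} u"
    using adm by (simp add: admissible_solution_def)
  obtain N where N: "negligible N" and "{x. \<not> solves_at h1 h2 u x} \<subseteq> N"
    using adm by (auto simp: admissible_solution_def eventually_ae_filter_negligible)
  then have solves: "solves_at h1 h2 u x" if "x \<notin> N" for x using that by blast
  obtain C' where C': "\<And>x. norm (u x) \<le> C' * (1 + \<bar>x\<bar>)"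
    using adm by (auto simp: admissible_solution_def)
  obtain p q where p: "\<And>y. deriv_right_limit u y (p y)" and q: "\<And>y. deriv_left_limit u y (q y)"
    and jump: "\<And>y. \<not> deriv_continuous_at u y \<Longrightarrow> p y $ 1 + p y $ 2 \<le> 0 \<or> q y $ 1 + q y $ 2 \<ge> 0"
    using adm unfolding admissible_solution_def by metis
  have off_N: "- N \<subseteq> diff_points u"
    using solves by (auto simp: diff_points_def solves_at_def)
  have deriv: "(u has_vector_derivative u' x) (at x)" if "x \<notin> N" for x
    using off_N that by (auto simp: diff_points_def u'_def vector_derivative_works)
  have p_lim: "(u' \<longlongrightarrow> p y) (at y within {y<..} - N)" for y
    using p[of y] off_N unfolding deriv_right_limit_def u'_def by (rule_tac tendsto_within_subset) auto
  have q_lim: "(u' \<longlongrightarrow> q y) (at y within {..<y} - N)" for y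
    using q[of y] off_N unfolding deriv_left_limit_def u'_def by (rule_tac tendsto_within_subset) auto
  have right: "(u has_vector_derivative p y) (at_right y)" for y
    by (rule right_vector_derivative[OF ac N deriv p_lim])
  have left: "(u has_vector_derivative q y) (at_left y)" for y
    by (rule left_vector_derivative[OF ac N deriv q_lim])
  have lims: "(p \<longlongrightarrow> p y) (at_right y)" "(p \<longlongrightarrow> q y) (at_left y)" for y
    by (rule right_derivatives_tendsto(1)[OF ac N deriv right p_lim],
        assumption, rule right_derivatives_tendsto(2)[OF ac N deriv right q_lim])
  have comp: "((\<lambda>x. u x $ i) has_real_derivative D $ i) F" if "(u has_vector_derivative D) F" for D i F
    using bounded_linear.has_vector_derivative[OF bounded_linear_vec_nth that]
    by (simp add: has_real_derivative_iff_has_vector_derivative)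
  have u_cont: "isCont (\<lambda>x. u x $ i) y" for i y
    using has_vector_derivative_continuous[OF right[of y]] has_vector_derivative_continuous[OF left[of y]]
    by (intro continuous_component) (simp add: continuous_at_split)
  have h_cont: "isCont h1 y" "isCont h2 y" for y
    using slope_bounds_isCont[of C h1 y] slope_bounds_isCont[of C h2 y] h1 h2 \<open>C > 1\<close> by auto
  \<comment> \<open>The equations hold off \<open>N\<close>; a limit along the complement of
    \<open>N\<close> carries them to every point, for either one-sided derivative.\<close>
  have eqs: "h1 y - u y $ 1 = r $ 1 * r $ 2 + (r $ 1)\<^sup>2 / 2 \<and> h2 y - u y $ 2 = r $ 1 * r $ 2 + (r $ 2)\<^sup>2 / 2"
    if lim: "(u' \<longlongrightarrow> r) (at y within S - N)" and nontriv: "at y within (S - N) \<noteq> bot" for y r S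
  proof -
    have ev: "\<forall>\<^sub>F x in at y within (S - N). solves_at h1 h2 u x"
      using solves by (auto simp: eventually_at_filter intro!: always_eventually)
    have r: "((\<lambda>x. u' x $ i) \<longlongrightarrow> r $ i) (at y within S - N)" for i
      by (intro tendsto_vec_nth lim)
    have lhs: "((\<lambda>x. h1 x - u x $ 1) \<longlongrightarrow> h1 y - u y $ 1) (at y within S - N)"
      "((\<lambda>x. h2 x - u x $ 2) \<longlongrightarrow> h2 y - u y $ 2) (at y within S - N)"
      by (rule tendsto_within_subset[OF continuous_diff[OF h_cont(1) u_cont, unfolded continuous_at] subset_UNIV],
          rule tendsto_within_subset[OF continuous_diff[OF h_cont(2) u_cont, unfolded continuous_at] subset_UNIV])
    have "((\<lambda>x. u' x $ 1 * u' x $ 2 + (u' x $ 1)\<^sup>2 / 2) \<longlongrightarrow> h1 y - u y $ 1) (at y within S - N)"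
      by (rule Lim_transform_eventually[OF lhs(1)], rule eventually_mono[OF ev])
        (auto simp: solves_at_def Let_def u'_def)
    moreover have "((\<lambda>x. u' x $ 1 * u' x $ 2 + (u' x $ 2)\<^sup>2 / 2) \<longlongrightarrow> h2 y - u y $ 2) (at y within S - N)"
      by (rule Lim_transform_eventually[OF lhs(2)], rule eventually_mono[OF ev])
        (auto simp: solves_at_def Let_def u'_def)
    moreover have "((\<lambda>x. u' x $ 1 * u' x $ 2 + (u' x $ i)\<^sup>2 / 2) \<longlongrightarrow> r $ 1 * r $ 2 + (r $ i)\<^sup>2 / 2)
        (at y within S - N)" for i
      by (intro tendsto_intros r) simp
    ultimately show ?thesis using tendsto_unique[OF nontriv] by blast
  qed
  note eq_p = eqs[OF p_lim at_within_Diff_negligible_nontrivial(1)[OF N]]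
  note eq_q = eqs[OF q_lim at_within_Diff_negligible_nontrivial(2)[OF N]]
  \<comment> \<open>Collects the growth constant of \<open>u\<close>, the values of
    \<open>h1\<close> and \<open>h2\<close> at 0 and the slope bound, so that one constant serves
    both components.\<close>
  define D where "D = \<bar>C'\<bar> + \<bar>h1 0\<bar> + \<bar>h2 0\<bar> + C"
  have lin: "\<bar>h x - u x $ i\<bar> \<le> D * (1 + \<bar>x\<bar>)"
    if h: "\<And>x y. x \<le> y \<Longrightarrow> (y - x) / C \<le> h y - h x" "\<And>x y. x \<le> y \<Longrightarrow> h y - h x \<le> C * (y - x)"
      and "\<bar>h 0\<bar> \<le> \<bar>h1 0\<bar> + \<bar>h2 0\<bar>" for h x i
  proof -
    have "\<bar>h x - h 0\<bar> \<le> C * \<bar>x\<bar>"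
    proof (cases "x \<ge> 0")
      case True
      moreover have "(x - 0) / C \<ge> 0" using True \<open>C > 1\<close> by simp
      ultimately show ?thesis using h[of 0 x] by simp
    next
      case False
      moreover have "(0 - x) / C \<ge> 0" using False \<open>C > 1\<close> by (intro divide_nonneg_pos) auto
      ultimately show ?thesis using h[of x 0] by simp
    qed
    moreover have "\<bar>u x $ i\<bar> \<le> \<bar>C'\<bar> * (1 + \<bar>x\<bar>)"
    proof -
      have "\<bar>u x $ i\<bar> \<le> norm (u x)" by (rule component_le_norm_cart)
      also have "\<dots> \<le> C' * (1 + \<bar>x\<bar>)" by (rule C')
      also have "\<dots> \<le> \<bar>C'\<bar> * (1 + \<bar>x\<bar>)" by (intro mult_right_mono) auto
      finally show ?thesis .
    qed
    moreover have "(\<bar>h1 0\<bar> + \<bar>h2 0\<bar>) * (1 + \<bar>x\<bar>) \<ge> \<bar>h1 0\<bar> + \<bar>h2 0\<bar>"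
      by (simp add: algebra_simps)
    ultimately have "\<bar>h x - u x $ i\<bar> \<le> \<bar>C'\<bar> * (1 + \<bar>x\<bar>) + (\<bar>h1 0\<bar> + \<bar>h2 0\<bar>) * (1 + \<bar>x\<bar>) + C * \<bar>x\<bar>"
      using that(3) by linarith
    also have "\<dots> \<le> D * (1 + \<bar>x\<bar>)" using \<open>C > 1\<close> by (simp add: D_def algebra_simps)
    finally show ?thesis .
  qed
  have "one_sided_solution C D h1 h2 (\<lambda>x. u x $ 1) (\<lambda>x. u x $ 2)
      (\<lambda>x. p x $ 1) (\<lambda>x. p x $ 2) (\<lambda>x. q x $ 1) (\<lambda>x. q x $ 2)"
  proof
    fix y
    show "p y $ 1 = q y $ 1 \<and> p y $ 2 = q y $ 2 \<or> p y $ 1 + p y $ 2 \<le> 0 \<or> 0 \<le> q y $ 1 + q y $ 2"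
    proof (cases "deriv_continuous_at u y")
      case True
      \<comment> \<open>\<open>deriv_continuous_at\<close> includes differentiability at
        \<open>y\<close>, so both one-sided derivatives equal the derivative there.\<close>
      then obtain D where "(u has_vector_derivative D) (at y)"
        by (auto simp: deriv_continuous_at_def diff_points_def vector_derivative_works)
      then have "(u has_vector_derivative D) (at_right y)" "(u has_vector_derivative D) (at_left y)"
        by (auto intro: has_vector_derivative_at_within)
      then have "p y = D" "q y = D"
        using vector_derivative_unique_within[OF _ right] vector_derivative_unique_within[OF _ left] by auto
      then show ?thesis by simp
    qed (use jump in auto)
    show "((\<lambda>x. p x $ 1) \<longlongrightarrow> p y $ 1) (at_right y)" "((\<lambda>x. p x $ 2) \<longlongrightarrow> p y $ 2) (at_right y)"
      by (rule tendsto_vec_nth[OF lims(1)])+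
    show "((\<lambda>x. p x $ 1) \<longlongrightarrow> q y $ 1) (at_left y)" "((\<lambda>x. p x $ 2) \<longlongrightarrow> q y $ 2) (at_left y)"
      by (rule tendsto_vec_nth[OF lims(2)])+
    show "\<bar>h1 y - u y $ 1\<bar> \<le> D * (1 + \<bar>y\<bar>)" by (rule lin[OF h1]) simp_all
    show "\<bar>h2 y - u y $ 2\<bar> \<le> D * (1 + \<bar>y\<bar>)" by (rule lin[OF h2]) simp_all
  qed (use \<open>C > 1\<close> h1 h2 eq_p eq_q comp[OF right] comp[OF left] in auto)
  then show ?thesis by blast
qed

lemma admissible_solution_unique:
  fixes u v :: "real \<Rightarrow> real ^ 2"
  assumes "admissible_solution h1 h2 u" "admissible_solution h1 h2 v" "C > 1"
    and "\<And>x y. x \<le> y \<Longrightarrow> (y - x) / C \<le> h1 y - h1 x" "\<And>x y. x \<le> y \<Longrightarrow> h1 y - h1 x \<le> C * (y - x)"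
    and "\<And>x y. x \<le> y \<Longrightarrow> (y - x) / C \<le> h2 y - h2 x" "\<And>x y. x \<le> y \<Longrightarrow> h2 y - h2 x \<le> C * (y - x)"
  shows "u = v"
proof -
  obtain D a1 a2 b1 b2 where "one_sided_solution C D h1 h2 (\<lambda>x. u x $ 1) (\<lambda>x. u x $ 2) a1 a2 b1 b2"
    using admissible_solution_one_sided[OF assms(1,3-7)] by blast
  moreover obtain D' a1' a2' b1' b2'
    where "one_sided_solution C D' h1 h2 (\<lambda>x. v x $ 1) (\<lambda>x. v x $ 2) a1' a2' b1' b2'"
    using admissible_solution_one_sided[OF assms(2,3-7)] by blast
  ultimately have "u x $ 1 = v x $ 1 \<and> u x $ 2 = v x $ 2" for x
    by (rule one_sided_solution_unique)
  then show ?thesis by (simp add: fun_eq_iff vec_eq_iff forall_2)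
qed

subsection \<open>Integration against an exponential kernel\<close>

lemma has_integral_atMost_FTC:
  fixes f F :: "real \<Rightarrow> real"
  assumes F: "\<And>t. (F has_real_derivative f t) (at t)" and cont: "\<And>t. isCont f t"
    and nonneg: "\<And>t. t < x \<Longrightarrow> 0 \<le> f t" and lim: "(F \<longlongrightarrow> 0) at_bot"
  shows "(f has_integral F x) {..x}"
proof -
  have eq: "einterval (-\<infinity>) (ereal x) = {..<x}" by (auto simp: einterval_def)
  have "isCont F x" using F DERIV_isCont by blast
  then have left: "(F \<longlongrightarrow> F x) (at_left x)"
    by (simp add: isCont_def filterlim_at_split)
  have int: "set_integrable lborel {..<x} f" and val: "(LBINT t=-\<infinity>..ereal x. f t) = F x - 0"
    using interval_integral_FTC_nonneg[of "-\<infinity>" "ereal x" F f 0 "F x"] F cont nonneg lim left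
    by (auto simp: eq ereal_tendsto_simps)
  have "(f has_integral F x) {..<x}"
    using set_borel_integral_eq_integral[OF int] val
    by (simp add: interval_lebesgue_integral_def eq has_integral_integral)
  then show ?thesis
    by (rule has_integral_spike_set_eq[THEN iffD1, rotated -1]) (auto intro: negligible_subset[of "{x}"])
qed

text \<open>The mass of the kernel normalises averages, and its first moment handles integrands of
  linear growth.\<close>

lemma exp_kernel_integrals:
  fixes l x :: real
  assumes "l > 0"
  shows "((\<lambda>t. exp (l * (t - x))) has_integral 1 / l) {..x}"
    and "((\<lambda>t. exp (l * (t - x)) * (x - t)) has_integral 1 / l\<^sup>2) {..x}"
proof -
  have lim: "filterlim (\<lambda>t. l * (x - t)) at_top at_bot"
    unfolding filterlim_at_bot_mirror
    by (rule filterlim_tendsto_pos_mult_at_top[OF tendsto_const \<open>l > 0\<close>])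
      (auto intro: filterlim_tendsto_add_at_top[OF tendsto_const filterlim_ident])
  have pw: "((\<lambda>t. (l * (x - t)) ^ k / exp (l * (x - t))) \<longlongrightarrow> 0) at_bot" for k
    using filterlim_compose[OF tendsto_power_div_exp_0 lim] .
  have e: "exp (l * (t - x)) = 1 / exp (l * (x - t))" for t
    by (simp add: exp_minus[symmetric] inverse_eq_divide[symmetric] algebra_simps)
  have "((\<lambda>t. exp (l * (t - x))) has_integral exp (l * (x - x)) / l) {..x}"
  proof (rule has_integral_atMost_FTC[where F = "\<lambda>t. exp (l * (t - x)) / l"])
    have "(\<lambda>t. exp (l * (t - x)) / l) = (\<lambda>t. (l * (x - t)) ^ 0 / exp (l * (x - t)) / l)"
      by (simp add: e)
    then show "((\<lambda>t. exp (l * (t - x)) / l) \<longlongrightarrow> 0) at_bot"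
      using tendsto_divide[OF pw[of 0] tendsto_const[of l]] \<open>l > 0\<close> by simp
  qed (use \<open>l > 0\<close> in \<open>auto intro!: derivative_eq_intros continuous_intros\<close>)
  then show "((\<lambda>t. exp (l * (t - x))) has_integral 1 / l) {..x}" by simp
  define F where "F t = exp (l * (t - x)) * ((x - t) / l + 1 / l\<^sup>2)" for t
  have "((\<lambda>t. exp (l * (t - x)) * (x - t)) has_integral F x) {..x}"
  proof (rule has_integral_atMost_FTC)
    have "F = (\<lambda>t. ((l * (x - t)) ^ 1 / exp (l * (x - t)) + (l * (x - t)) ^ 0 / exp (l * (x - t))) / l\<^sup>2)"
    proof
      fix t
      define E where "E = exp (l * (x - t))"
      have "E > 0" by (simp add: E_def)
      then show "F t = ((l * (x - t)) ^ 1 / exp (l * (x - t)) + (l * (x - t)) ^ 0 / exp (l * (x - t))) / l\<^sup>2"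
        unfolding F_def e E_def[symmetric] using \<open>l > 0\<close> by (simp add: field_simps power2_eq_square)
    qed
    then show "(F \<longlongrightarrow> 0) at_bot"
      using tendsto_divide[OF tendsto_add[OF pw[of 1] pw[of 0]] tendsto_const[of "l\<^sup>2"]] \<open>l > 0\<close> by simp
    show "(F has_real_derivative exp (l * (t - x)) * (x - t)) (at t)" for t
      unfolding F_def using \<open>l > 0\<close>
      by (auto intro!: derivative_eq_intros simp: field_simps power2_eq_square)
  qed (auto intro!: continuous_intros)
  then show "((\<lambda>t. exp (l * (t - x)) * (x - t)) has_integral 1 / l\<^sup>2) {..x}"
    by (simp add: F_def)
qed

context
  fixes l A B :: real and g :: "real \<Rightarrow> 'a::euclidean_space"
  assumes l: "l > 0" and cont: "continuous_on UNIV g" and bound: "\<And>t. norm (g t) \<le> A + B * \<bar>t\<bar>"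
    and B: "B \<ge> 0"
begin

lemma exp_kernel_integrable: "(\<lambda>t. exp (l * (t - x)) *\<^sub>R g t) integrable_on {..x}"
proof (rule measurable_bounded_by_integrable_imp_integrable)
  show "(\<lambda>t. exp (l * (t - x)) *\<^sub>R g t) \<in> borel_measurable (lebesgue_on {..x})"
    by (intro continuous_imp_measurable_on_sets_lebesgue continuous_intros
        continuous_on_subset[OF cont]) auto
  show "(\<lambda>t. exp (l * (t - x)) * (A + B * \<bar>x\<bar>) + B * (exp (l * (t - x)) * (x - t))) integrable_on {..x}"
    using exp_kernel_integrals[OF l, of x]
    by (intro integrable_add integrable_on_mult_left integrable_on_mult_right) blast+
  fix t assume "t \<in> {..x}"
  then have "B * \<bar>t\<bar> \<le> B * (\<bar>x\<bar> + (x - t))" using B by (intro mult_left_mono) auto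
  then have "norm (g t) \<le> A + B * \<bar>x\<bar> + B * (x - t)" using bound[of t] by (simp add: algebra_simps)
  then have "exp (l * (t - x)) * norm (g t) \<le> exp (l * (t - x)) * (A + B * \<bar>x\<bar> + B * (x - t))"
    by (intro mult_left_mono) auto
  then show "norm (exp (l * (t - x)) *\<^sub>R g t)
      \<le> exp (l * (t - x)) * (A + B * \<bar>x\<bar>) + B * (exp (l * (t - x)) * (x - t))"
    by (simp add: algebra_simps)
qed auto

text \<open>\<open>U y\<close> is exp (- l y) times the primitive of \<open>c\<close>, so the
  product rule applies. The primitive is split at \<open>x - 1\<close> to use the fundamental
  theorem on a compact interval.\<close>

lemma exp_kernel_has_vector_derivative:
  defines "U \<equiv> \<lambda>x. integral {..x} (\<lambda>t. exp (l * (t - x)) *\<^sub>R g t)"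
  shows "(U has_vector_derivative g x - l *\<^sub>R U x) (at x)"
proof -
  define c where "c t = exp (l * t) *\<^sub>R g t" for t
  have kernel: "exp (l * (t - y)) *\<^sub>R g t = exp (- l * y) *\<^sub>R c t" for t y
    by (simp add: c_def exp_add[symmetric] algebra_simps)
  have U: "U y = exp (- l * y) *\<^sub>R integral {..y} c" for y
    unfolding U_def kernel by simp
  have c_eq: "c t = exp (l * y) *\<^sub>R (exp (l * (t - y)) *\<^sub>R g t)" for t y
    unfolding kernel by (simp add: exp_add[symmetric])
  have c_int: "c integrable_on {..y}" for y
    unfolding c_eq[of _ y] by (intro integrable_cmul exp_kernel_integrable)
  have c_cont: "continuous_on X c" for X
    unfolding c_def by (intro continuous_intros continuous_on_subset[OF cont]) auto
  have comb: "integral {..y} c = integral {..x - 1} c + integral {x - 1..y} c" if "x - 1 \<le> y" for y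
  proof (rule integral_unique)
    have "{..y} = {..x - 1} \<union> {x - 1..y}" using that by auto
    moreover have "(c has_integral integral {..x - 1} c + integral {x - 1..y} c) ({..x - 1} \<union> {x - 1..y})"
      by (intro has_integral_Un integrable_integral c_int integrable_continuous_interval c_cont)
        (auto intro: negligible_subset[of "{x - 1}"])
    ultimately show "(c has_integral integral {..x - 1} c + integral {x - 1..y} c) {..y}" by simp
  qed
  have "((\<lambda>y. integral {x - 1..y} c) has_vector_derivative c x) (at x within {x - 1..x + 1})"
    by (intro integral_has_vector_derivative c_cont) auto
  then have "((\<lambda>y. integral {x - 1..y} c) has_vector_derivative c x) (at x)"
    by (simp add: at_within_Icc_at)
  then have "((\<lambda>y. integral {..x - 1} c + integral {x - 1..y} c) has_vector_derivative c x) (at x)"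
    using has_vector_derivative_add[OF has_vector_derivative_const] by fastforce
  then have I: "((\<lambda>y. integral {..y} c) has_vector_derivative c x) (at x)"
    by (rule has_vector_derivative_transform_within_open[of _ _ _ "{x - 1<..<x + 1}"])
      (simp, simp, rule comb[symmetric], simp)
  have "((\<lambda>y. exp (- l * y)) has_real_derivative - l * exp (- l * x)) (at x)"
    by (auto intro!: derivative_eq_intros)
  from has_vector_derivative_scaleR[OF this I]
  have "(U has_vector_derivative exp (- l * x) *\<^sub>R c x + (- l * exp (- l * x)) *\<^sub>R integral {..x} c) (at x)"
    unfolding U .
  moreover have "exp (- l * x) *\<^sub>R c x = g x"
    by (simp add: c_def exp_add[symmetric])
  ultimately show ?thesis by (simp add: U)
qed

end

subsection \<open>The inverse of the quadratic map\<close>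

text \<open>With s = p + q, d = p - q and S = s^2, the relation a - b = s d / 2 gives d, and a + b =
  3 S / 4 - (a - b)^2 / S becomes 3 S^2 - 4 (a + b) S - 4 (a - b)^2 = 0. \<open>S\<close> is the
  positive root.\<close>

lemma quad_root_exists:
  fixes a b :: real
  assumes "a > 0" "b > 0"
  shows "\<exists>p q. p > 0 \<and> q > 0 \<and> p * q + p\<^sup>2 / 2 = a \<and> p * q + q\<^sup>2 / 2 = b"
proof -
  define R where "R = sqrt (4 * (a + b)\<^sup>2 + 12 * (a - b)\<^sup>2)"
  define S where "S = (2 * (a + b) + R) / 3"
  define s where "s = sqrt S"
  define p q where "p = s / 2 + (a - b) / s" and "q = s / 2 - (a - b) / s"
  have "R \<ge> 0" by (simp add: R_def)
  then have "S > 0" using assms by (simp add: S_def)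
  then have s: "s > 0" "s\<^sup>2 = S" by (simp_all add: s_def)
  have "(3 * S - 2 * (a + b))\<^sup>2 = 4 * (a + b)\<^sup>2 + 12 * (a - b)\<^sup>2"
  proof -
    have "3 * S - 2 * (a + b) = R" by (simp add: S_def field_simps)
    then show ?thesis by (simp add: R_def)
  qed
  then have quad: "3 * S\<^sup>2 = 4 * (a + b) * S + 4 * (a - b)\<^sup>2"
    by (simp add: power2_eq_square algebra_simps)
  have "p * q = S / 4 - (a - b)\<^sup>2 / S"
    using s(1) unfolding p_def q_def s(2)[symmetric] by (simp add: power2_eq_square field_simps)
  moreover have "p\<^sup>2 = S / 4 + (a - b) + (a - b)\<^sup>2 / S" "q\<^sup>2 = S / 4 - (a - b) + (a - b)\<^sup>2 / S"
    using s(1) unfolding p_def q_def s(2)[symmetric] by (simp_all add: power2_eq_square field_simps)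
  moreover have "(a - b)\<^sup>2 / S = 3 * S / 4 - (a + b)"
    using quad \<open>S > 0\<close> by (simp add: field_simps power2_eq_square)
  ultimately have eqs: "p * q + p\<^sup>2 / 2 = a" "p * q + q\<^sup>2 / 2 = b"
    by (simp_all add: field_simps)
  moreover have "p + q > 0" using s(1) by (simp add: p_def q_def)
  ultimately have "p > 0 \<and> q > 0" using quad_both_pos[of p q] assms by auto
  then show ?thesis using eqs by blast
qed

text \<open>Unique by \<open>quad_two_to_one\<close> when both components of \<open>w\<close> are
  positive; an arbitrary value otherwise.\<close>

definition quad_root :: "real ^ 2 \<Rightarrow> real ^ 2" where
  "quad_root w = (SOME p. p $ 1 > 0 \<and> p $ 2 > 0 \<and>
     p $ 1 * p $ 2 + (p $ 1)\<^sup>2 / 2 = w $ 1 \<and> p $ 1 * p $ 2 + (p $ 2)\<^sup>2 / 2 = w $ 2)"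

lemma quad_root:
  assumes "w $ 1 > 0" "w $ 2 > 0"
  shows "quad_root w $ 1 > 0" "quad_root w $ 2 > 0"
    and "quad_root w $ 1 * quad_root w $ 2 + (quad_root w $ 1)\<^sup>2 / 2 = w $ 1"
    and "quad_root w $ 1 * quad_root w $ 2 + (quad_root w $ 2)\<^sup>2 / 2 = w $ 2"
proof -
  obtain p q where "p > 0" "q > 0" "p * q + p\<^sup>2 / 2 = w $ 1" "p * q + q\<^sup>2 / 2 = w $ 2"
    using quad_root_exists[OF assms] by blast
  then have "\<exists>p :: real ^ 2. p $ 1 > 0 \<and> p $ 2 > 0 \<and>
     p $ 1 * p $ 2 + (p $ 1)\<^sup>2 / 2 = w $ 1 \<and> p $ 1 * p $ 2 + (p $ 2)\<^sup>2 / 2 = w $ 2"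
    by (intro exI[of _ "vector [p, q]"]) simp
  from someI_ex[OF this] show "quad_root w $ 1 > 0" "quad_root w $ 2 > 0"
    "quad_root w $ 1 * quad_root w $ 2 + (quad_root w $ 1)\<^sup>2 / 2 = w $ 1"
    "quad_root w $ 1 * quad_root w $ 2 + (quad_root w $ 2)\<^sup>2 / 2 = w $ 2"
    unfolding quad_root_def by blast+
qed

text \<open>A square on whose boundary the field \<open>h' - quad_root w\<close> points inwards whenever
  \<open>1/C \<le> h' \<le> C\<close>.\<close>

definition trap :: "real \<Rightarrow> (real ^ 2) set" where
  "trap C = {w. \<forall>i. 1 / (4 * C\<^sup>2) \<le> w $ i \<and> w $ i \<le> 8 * C\<^sup>2}"

lemma trap_eq_cbox: "trap C = cbox (\<chi> i. 1 / (4 * C\<^sup>2)) (\<chi> i. 8 * C\<^sup>2)"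
  by (auto simp: trap_def mem_box_cart)

lemma norm_vec2: "(norm v)\<^sup>2 = (v $ 1)\<^sup>2 + (v $ 2)\<^sup>2" for v :: "real ^ 2"
  unfolding power2_norm_eq_inner inner_vec_def sum_2 by (simp add: power2_eq_square)

context
  fixes C :: real
  assumes C: "C > 1"
begin

lemma trap_pos: "w \<in> trap C \<Longrightarrow> w $ i > 0"
proof -
  assume "w \<in> trap C"
  then have "1 / (4 * C\<^sup>2) \<le> w $ i" by (simp add: trap_def)
  moreover have "1 / (4 * C\<^sup>2) > 0" using C by simp
  ultimately show ?thesis by linarith
qed

text \<open>As p1 p2 > 0, the square of p_i is at most 2 w_i, hence at most 16 C^2. The lower bound
  uses that (p1 + p2)^2 is at least w1 + w2.\<close>

lemma trap_root_bounds:
  assumes "w \<in> trap C"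
  shows "quad_root w $ i > 0" "quad_root w $ i \<le> 4 * C" "(quad_root w $ i)\<^sup>2 \<le> 2 * w $ i"
    and "1 / (2 * C) \<le> quad_root w $ 1 + quad_root w $ 2"
proof -
  let ?p = "quad_root w"
  note r = quad_root[OF trap_pos[OF assms] trap_pos[OF assms]]
  show pos: "?p $ i > 0" for i using r(1,2) exhaust_2[of i] by auto
  have "?p $ 1 * ?p $ 2 > 0" using pos by simp
  then show sq: "(?p $ i)\<^sup>2 \<le> 2 * w $ i" for i using r(3,4) exhaust_2[of i] by auto
  show "?p $ i \<le> 4 * C"
  proof -
    have "w $ i \<le> 8 * C\<^sup>2" using assms by (simp add: trap_def)
    then have "(?p $ i)\<^sup>2 \<le> (4 * C)\<^sup>2" using sq[of i] by (simp add: power_mult_distrib)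
    then show ?thesis using C by (intro power2_le_imp_le[of "?p $ i"]) auto
  qed
  have "w $ 1 \<ge> 1 / (4 * C\<^sup>2)" "w $ 2 > 0" using assms trap_pos by (auto simp: trap_def)
  then have "(1 / (2 * C))\<^sup>2 \<le> (?p $ 1 + ?p $ 2)\<^sup>2"
    using quad_sum_le(1)[of "?p $ 1" "?p $ 2"] \<open>?p $ 1 * ?p $ 2 > 0\<close> r(3,4)
    by (simp add: power_mult_distrib power_divide)
  then show "1 / (2 * C) \<le> ?p $ 1 + ?p $ 2"
    using pos[of 1] pos[of 2] by (intro power2_le_imp_le[of "1 / (2 * C)"]) auto
qed

text \<open>The bounds are the edge values of \<open>a\<close> with p replaced by 1/C and by C. Near
  the lower edge p^2 <= 2 a gives p <= 1/C; away from it the factor 16 C^3 lifts the term in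
  \<open>a\<close> by at least 4 C >= p. For the upper bound, p < C leaves a <= 5 C^2, well below 8
  C^2.\<close>

lemma trap_barrier_aux:
  assumes pq: "0 < p" "p \<le> 4 * C" "0 < q" "q \<le> 4 * C" and a: "p * q + p\<^sup>2 / 2 = a" and "p\<^sup>2 \<le> 2 * a"
    and a_bounds: "1 / (4 * C\<^sup>2) \<le> a" "a \<le> 8 * C\<^sup>2"
  shows "16 * C ^ 3 * (1 / (4 * C\<^sup>2)) - 1 / C \<le> 16 * C ^ 3 * a - p"
    and "16 * C ^ 3 * a - p \<le> 16 * C ^ 3 * (8 * C\<^sup>2) - C"
proof -
  let ?l = "16 * C ^ 3"
  have l: "?l > 0" using C by simp
  show "?l * (1 / (4 * C\<^sup>2)) - 1 / C \<le> ?l * a - p"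
  proof (cases "a \<le> 1 / (2 * C\<^sup>2)")
    case True
    then have "p\<^sup>2 \<le> (1 / C)\<^sup>2" using \<open>p\<^sup>2 \<le> 2 * a\<close> by (simp add: power_divide)
    then have "p \<le> 1 / C" using C by (intro power2_le_imp_le[of p]) auto
    moreover have "?l * (1 / (4 * C\<^sup>2)) \<le> ?l * a" using l a_bounds(1) by (intro mult_left_mono) auto
    ultimately show ?thesis by linarith
  next
    case False
    then have "?l * (1 / (2 * C\<^sup>2)) \<le> ?l * a" using l by (intro mult_left_mono) auto
    moreover have "?l * (1 / (2 * C\<^sup>2)) = 8 * C" "?l * (1 / (4 * C\<^sup>2)) = 4 * C"
      using C by (simp_all add: field_simps power2_eq_square power3_eq_cube)
    moreover have "1 / C > 0" using C by simp
    ultimately show ?thesis using pq by linarith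
  qed
  show "?l * a - p \<le> ?l * (8 * C\<^sup>2) - C"
  proof (cases "p \<ge> C")
    case True
    moreover have "?l * a \<le> ?l * (8 * C\<^sup>2)" using l a_bounds(2) by (intro mult_left_mono) auto
    ultimately show ?thesis by linarith
  next
    case False
    have "p * q \<le> C * (4 * C)" using False pq by (intro mult_mono) auto
    moreover have "p\<^sup>2 \<le> C\<^sup>2" using False pq by (intro power_mono) auto
    ultimately have "a \<le> 5 * C\<^sup>2" using a zero_le_power2[of C] unfolding power2_eq_square by linarith
    then have "?l * a \<le> ?l * (5 * C\<^sup>2)" using l by (intro mult_left_mono) auto
    moreover have "C \<le> ?l * (3 * C\<^sup>2)"
    proof -
      have "1 \<le> C ^ 4" using C by (intro one_le_power) simp
      then have "1 \<le> 48 * C ^ 4" by linarith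
      then have "C * 1 \<le> C * (48 * C ^ 4)" using C by (intro mult_left_mono) auto
      then show ?thesis by (simp add: numeral_eq_Suc algebra_simps)
    qed
    ultimately show ?thesis using pq by (simp add: algebra_simps)
  qed
qed

lemma trap_barrier:
  assumes "w \<in> trap C"
  shows "16 * C ^ 3 * (1 / (4 * C\<^sup>2)) - 1 / C \<le> 16 * C ^ 3 * w $ i - quad_root w $ i"
    and "16 * C ^ 3 * w $ i - quad_root w $ i \<le> 16 * C ^ 3 * (8 * C\<^sup>2) - C"
proof -
  note r = quad_root[OF trap_pos[OF assms] trap_pos[OF assms]] and b = trap_root_bounds[OF assms]
  have w: "1 / (4 * C\<^sup>2) \<le> w $ j" "w $ j \<le> 8 * C\<^sup>2" for j
    using assms by (auto simp: trap_def)
  have e: "quad_root w $ 2 * quad_root w $ 1 + (quad_root w $ 2)\<^sup>2 / 2 = w $ 2"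
    using r(4) by (simp add: mult.commute)
  consider "i = 1" | "i = 2" using exhaust_2 by blast
  then show "16 * C ^ 3 * (1 / (4 * C\<^sup>2)) - 1 / C \<le> 16 * C ^ 3 * w $ i - quad_root w $ i"
    "16 * C ^ 3 * w $ i - quad_root w $ i \<le> 16 * C ^ 3 * (8 * C\<^sup>2) - C"
    using trap_barrier_aux[OF b(1,2) b(1,2) r(3) b(3) w] trap_barrier_aux[OF b(1,2) b(1,2) e b(3) w]
    by (cases; simp only:)+
qed

text \<open>Strong monotonicity of \<open>quad_root\<close> makes the identity minus a small multiple of it a
  strict contraction.\<close>

lemma trap_contraction:
  assumes w: "w \<in> trap C" and w': "w' \<in> trap C"
  defines "l \<equiv> 16 * C ^ 3"
  shows "norm (l *\<^sub>R (w - w') - (quad_root w - quad_root w')) \<le> sqrt (l\<^sup>2 - l / (64 * C)) * norm (w - w')"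
    and "norm (quad_root w - quad_root w') \<le> l * norm (w - w')"
proof -
  note r = quad_root[OF trap_pos[OF w] trap_pos[OF w]] and b = trap_root_bounds[OF w]
  note r' = quad_root[OF trap_pos[OF w'] trap_pos[OF w']] and b' = trap_root_bounds[OF w']
  define p p' where "p = quad_root w" and "p' = quad_root w'"
  define S where "S = (p $ 1 + p $ 2 + p' $ 1 + p' $ 2) / 2"
  define v q where "v = w - w'" and "q = p - p'"
  have l: "l > 0" using C by (simp add: l_def)
  have S_lower: "1 / (2 * C) \<le> S" using b(4) b'(4) by (simp add: S_def p_def p'_def)
  have S_upper: "S \<le> 8 * C"
    using b(2)[of 1] b(2)[of 2] b'(2)[of 1] b'(2)[of 2] by (simp add: S_def p_def p'_def)
  have "S > 0" using S_lower C by (smt (verit) divide_pos_pos)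
  have lS: "2 \<le> l * S"
  proof -
    have "1 \<le> C\<^sup>2" using C by simp
    then have "2 \<le> l * (1 / (2 * C))"
      using C by (simp add: l_def power2_eq_square power3_eq_cube field_simps)
    also have "\<dots> \<le> l * S" using S_lower l by (intro mult_left_mono) auto
    finally show ?thesis .
  qed
  have mono: "S / 2 * (norm q)\<^sup>2 \<le> v \<bullet> q"
    using quad_strongly_monotone[OF r(1,2) r'(1,2)] r(3,4) r'(3,4)
    by (simp add: norm_vec2 inner_vec_def sum_2 v_def q_def p_def p'_def S_def)
  have lip: "(norm v)\<^sup>2 \<le> 4 * S\<^sup>2 * (norm q)\<^sup>2"
    using quad_lipschitz[OF r(1,2) r'(1,2)] r(3,4) r'(3,4)
    by (simp add: norm_vec2 v_def q_def p_def p'_def S_def)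
  \<comment> \<open>Since l S >= 2, strong monotonicity absorbs |q|^2 in one of the two copies of l
    (v . q) in the expansion of |l v - q|^2; the other copy gives the contraction.\<close>
  have q_le: "(norm q)\<^sup>2 \<le> l * (v \<bullet> q)"
  proof -
    have "1 * (norm q)\<^sup>2 \<le> l * S / 2 * (norm q)\<^sup>2" using lS by (intro mult_right_mono) auto
    also have "\<dots> = l * (S / 2 * (norm q)\<^sup>2)" by simp
    also have "\<dots> \<le> l * (v \<bullet> q)" using mono l by (intro mult_left_mono) auto
    finally show ?thesis by simp
  qed
  \<comment> \<open>The constant 64 C is 8 S at the upper bound S = 8 C.\<close>
  have inner_lower: "(norm v)\<^sup>2 / (64 * C) \<le> v \<bullet> q"
  proof -
    have "(norm v)\<^sup>2 / (8 * S) \<le> S / 2 * (norm q)\<^sup>2"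
      using lip \<open>S > 0\<close> by (simp add: field_simps power2_eq_square)
    moreover have "(norm v)\<^sup>2 / (64 * C) \<le> (norm v)\<^sup>2 / (8 * S)"
      using S_upper \<open>S > 0\<close> by (intro divide_left_mono) auto
    ultimately show ?thesis using mono by linarith
  qed
  have "(norm (l *\<^sub>R v - q))\<^sup>2 = l\<^sup>2 * (norm v)\<^sup>2 - 2 * l * (v \<bullet> q) + (norm q)\<^sup>2"
    unfolding power2_norm_eq_inner
    by (simp add: inner_diff_left inner_diff_right inner_commute power2_eq_square)
  also have "\<dots> \<le> l\<^sup>2 * (norm v)\<^sup>2 - l * (v \<bullet> q)" using q_le by simp
  also have "\<dots> \<le> l\<^sup>2 * (norm v)\<^sup>2 - l * ((norm v)\<^sup>2 / (64 * C))"
    using mult_left_mono[OF inner_lower, of l] l by simp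
  also have "\<dots> = (l\<^sup>2 - l / (64 * C)) * (norm v)\<^sup>2" by (simp add: algebra_simps)
  finally have "sqrt ((norm (l *\<^sub>R v - q))\<^sup>2) \<le> sqrt ((l\<^sup>2 - l / (64 * C)) * (norm v)\<^sup>2)"
    by (rule real_sqrt_le_mono)
  then show "norm (l *\<^sub>R (w - w') - (quad_root w - quad_root w')) \<le> sqrt (l\<^sup>2 - l / (64 * C)) * norm (w - w')"
    by (simp add: real_sqrt_mult v_def q_def p_def p'_def)
  have "(norm q)\<^sup>2 \<le> (l * norm v) * norm q"
    using q_le norm_cauchy_schwarz[of v q] l by (smt (verit) mult.assoc mult_left_mono)
  then have "norm q \<le> l * norm v"
    using l by (cases "norm q = 0") (auto simp: power2_eq_square)
  then show "norm (quad_root w - quad_root w') \<le> l * norm (w - w')"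
    by (simp add: v_def q_def p_def p'_def)
qed

lemma continuous_on_quad_root: "continuous_on (trap C) quad_root"
proof -
  have "(16 * C ^ 3)-lipschitz_on (trap C) quad_root"
    using trap_contraction(2) C by (intro lipschitz_onI) (auto simp: dist_norm)
  then show ?thesis by (rule lipschitz_on_continuous_on)
qed

end

subsection \<open>The fixed point argument\<close>

context
  fixes C :: real and h :: "real \<Rightarrow> real ^ 2"
  assumes C: "C > 1"
    and h_slope: "\<And>x y i. x \<le> y \<Longrightarrow> (y - x) / C \<le> h y $ i - h x $ i"
      "\<And>x y i. x \<le> y \<Longrightarrow> h y $ i - h x $ i \<le> C * (y - x)"
begin

abbreviation (input) "rate \<equiv> 16 * C ^ 3"

lemma rate_pos: "rate > 0"
  using C by simp

definition forcing :: "(real \<Rightarrow> real ^ 2) \<Rightarrow> real \<Rightarrow> real ^ 2" where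
  "forcing w t = rate *\<^sub>R (h t - w t) + quad_root (w t)"

text \<open>The fixed points \<open>w\<close> of this map are the functions for which \<open>u = h - w\<close> is the solution
  of \<open>u' = - rate * u + forcing w\<close> of at most linear growth, that is, \<open>u' = quad_root (h - u)\<close>.\<close>

definition trap_map :: "(real \<Rightarrow> real ^ 2) \<Rightarrow> real \<Rightarrow> real ^ 2" where
  "trap_map w x = h x - integral {..x} (\<lambda>t. exp (rate * (t - x)) *\<^sub>R forcing w t)"

lemma h_lipschitz: "norm (h y - h x) \<le> 2 * C * \<bar>y - x\<bar>"
proof -
  have *: "\<bar>h b $ i - h a $ i\<bar> \<le> C * (b - a)" if "a \<le> b" for a b i
  proof -
    have "(b - a) / C \<ge> 0" using that C by simp
    then show ?thesis using h_slope[OF that, of i] by linarith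
  qed
  have "\<bar>h y $ i - h x $ i\<bar> \<le> C * \<bar>y - x\<bar>" for i
    using *[of x y i] *[of y x i] by (cases "x \<le> y") (simp_all add: abs_minus_commute)
  then have "(\<Sum>i\<in>UNIV. \<bar>(h y - h x) $ i\<bar>) \<le> (\<Sum>i\<in>(UNIV :: 2 set). C * \<bar>y - x\<bar>)"
    by (intro sum_mono) simp
  then show ?thesis using norm_le_l1_cart[of "h y - h x"] by simp
qed

lemma continuous_on_h: "continuous_on X h"
proof -
  have "(2 * C)-lipschitz_on X h"
    using h_lipschitz C by (intro lipschitz_onI) (auto simp: dist_norm abs_minus_commute)
  then show ?thesis by (rule lipschitz_on_continuous_on)
qed

lemma forcing_bound:
  assumes "range w \<subseteq> trap C"
  shows "norm (forcing w t) \<le> (rate * (norm (h 0) + 16 * C\<^sup>2) + 8 * C) + (rate * (2 * C)) * \<bar>t\<bar>"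
proof -
  have "w t \<in> trap C" using assms by blast
  note p = trap_root_bounds[OF C this] and w_pos = trap_pos[OF C this]
  have "norm (quad_root (w t)) \<le> 8 * C"
    using norm_le_l1_cart[of "quad_root (w t)"] p(1)[of 1] p(1)[of 2] p(2)[of 1] p(2)[of 2]
    by (simp add: sum_2)
  moreover have "norm (w t) \<le> 16 * C\<^sup>2"
    using norm_le_l1_cart[of "w t"] w_pos[of 1] w_pos[of 2] \<open>w t \<in> trap C\<close>
    by (simp add: sum_2 trap_def) (smt (verit))
  moreover have "norm (h t) \<le> norm (h 0) + 2 * C * \<bar>t\<bar>"
    using h_lipschitz[of t 0] norm_triangle_ineq2[of "h t" "h 0"] by simp
  ultimately have "norm (h t - w t) \<le> norm (h 0) + 2 * C * \<bar>t\<bar> + 16 * C\<^sup>2"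
    using norm_triangle_ineq4[of "h t" "w t"] by linarith
  then have "norm (rate *\<^sub>R (h t - w t)) \<le> rate * (norm (h 0) + 2 * C * \<bar>t\<bar> + 16 * C\<^sup>2)"
    using C by simp
  then show ?thesis
    using norm_triangle_ineq[of "rate *\<^sub>R (h t - w t)" "quad_root (w t)"] \<open>norm (quad_root (w t)) \<le> 8 * C\<close>
    unfolding forcing_def by (simp add: distrib_left mult.assoc)
qed

context
  fixes w :: "real \<Rightarrow> real ^ 2"
  assumes w_cont: "continuous_on UNIV w" and w_trap: "range w \<subseteq> trap C"
begin

lemma continuous_on_root_w: "continuous_on UNIV (\<lambda>t. quad_root (w t))"
  by (rule continuous_on_compose2[OF continuous_on_quad_root[OF C] w_cont w_trap])

lemma continuous_on_forcing: "continuous_on UNIV (forcing w)"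
  unfolding forcing_def by (intro continuous_intros continuous_on_h w_cont continuous_on_root_w)

lemma forcing_kernel_integrable:
  "(\<lambda>t. exp (rate * (t - x)) *\<^sub>R forcing w t) integrable_on {..x}"
  by (rule exp_kernel_integrable[OF rate_pos continuous_on_forcing forcing_bound[OF w_trap]])
    (use C in simp)

lemma trap_map_derivative:
  "((\<lambda>x. h x - trap_map w x) has_vector_derivative forcing w x - rate *\<^sub>R (h x - trap_map w x)) (at x)"
  using exp_kernel_has_vector_derivative[OF rate_pos continuous_on_forcing forcing_bound[OF w_trap], of x] C
  by (simp add: trap_map_def)

lemma continuous_on_trap_map: "continuous_on UNIV (trap_map w)"
proof -
  have "continuous_on UNIV (\<lambda>x. h x - trap_map w x)"
    using trap_map_derivative has_vector_derivative_continuous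
    by (blast intro: continuous_at_imp_continuous_on)
  from continuous_on_diff[OF continuous_on_h this] show ?thesis by simp
qed

text \<open>The kernel has mass 1 / rate, so \<open>h x\<close> is itself such an integral. Then
  \<open>h\<close> enters only through the increments h x - h t, which the slope bounds
  control.\<close>

lemma trap_map_has_integral:
  "((\<lambda>t. exp (rate * (t - x)) *\<^sub>R (rate *\<^sub>R (h x - h t) + (rate *\<^sub>R w t - quad_root (w t))))
    has_integral trap_map w x) {..x}"
proof -
  have "((\<lambda>t. exp (rate * (t - x)) *\<^sub>R (rate *\<^sub>R h x)) has_integral (1 / rate) *\<^sub>R (rate *\<^sub>R h x)) {..x}"
    by (rule has_integral_scaleR_left[OF exp_kernel_integrals(1)[OF rate_pos]])
  then have "((\<lambda>t. exp (rate * (t - x)) *\<^sub>R (rate *\<^sub>R h x)) has_integral h x) {..x}"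
    using rate_pos by simp
  from has_integral_diff[OF this integrable_integral[OF forcing_kernel_integrable]]
  show ?thesis by (simp add: trap_map_def forcing_def algebra_simps)
qed

text \<open>The slope bound c (x - t), with c = 1/C or C, contributes c / rate through the first
  moment of the kernel. This cancels the - c / rate from \<open>trap_barrier\<close>, and exactly
  the edge of the square remains.\<close>

lemma trap_map_in_trap: "trap_map w x \<in> trap C"
proof -
  have wt: "w t \<in> trap C" for t using w_trap by blast
  have "1 / (4 * C\<^sup>2) \<le> trap_map w x $ i \<and> trap_map w x $ i \<le> 8 * C\<^sup>2" for i
  proof -
    let ?e = "\<lambda>t. exp (rate * (t - x))"
    let ?f = "\<lambda>t. rate * (h x $ i - h t $ i) + (rate * w t $ i - quad_root (w t) $ i)"
    have T: "((\<lambda>t. ?e t * ?f t) has_integral trap_map w x $ i) {..x}"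
      using has_integral_linear[OF trap_map_has_integral bounded_linear_vec_nth[of i]]
      by (simp add: o_def)
    have lin: "((\<lambda>t. ?e t * (rate * (c * (x - t)) + d)) has_integral c / rate + d / rate) {..x}" for c d
    proof -
      have "((\<lambda>t. (rate * c) * (?e t * (x - t)) + d * ?e t) has_integral (rate * c) * (1 / rate\<^sup>2) + d * (1 / rate)) {..x}"
        by (intro has_integral_add has_integral_mult_right exp_kernel_integrals rate_pos)
      moreover have "(rate * c) * (1 / rate\<^sup>2) + d * (1 / rate) = c / rate + d / rate"
        using rate_pos by (simp only: power2_eq_square) (simp add: field_simps)
      ultimately show ?thesis by (simp add: algebra_simps)
    qed
    let ?lo = "rate * (1 / (4 * C\<^sup>2)) - 1 / C" and ?hi = "rate * (8 * C\<^sup>2) - C"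
    have "(1 / C) / rate + ?lo / rate \<le> trap_map w x $ i"
    proof (rule has_integral_le[OF lin T])
      fix t assume "t \<in> {..x}"
      then have "rate * ((1 / C) * (x - t)) \<le> rate * (h x $ i - h t $ i)"
        using h_slope(1)[of t x i] rate_pos by (intro mult_left_mono) auto
      then show "?e t * (rate * ((1 / C) * (x - t)) + ?lo) \<le> ?e t * ?f t"
        using trap_barrier(1)[OF C wt, of t i] by (intro mult_left_mono) auto
    qed
    moreover have "trap_map w x $ i \<le> C / rate + ?hi / rate"
    proof (rule has_integral_le[OF T lin])
      fix t assume "t \<in> {..x}"
      then have "rate * (h x $ i - h t $ i) \<le> rate * (C * (x - t))"
        using h_slope(2)[of t x i] rate_pos by (intro mult_left_mono) auto
      then show "?e t * ?f t \<le> ?e t * (rate * (C * (x - t)) + ?hi)"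
        using trap_barrier(2)[OF C wt, of t i] by (intro mult_left_mono) auto
    qed
    moreover have "c / rate + (rate * a - c) / rate = a" for a c
      using rate_pos by (simp only: add_divide_distrib[symmetric]) simp
    ultimately show ?thesis by metis
  qed
  then show ?thesis by (simp add: trap_def)
qed

end

text \<open>The Lipschitz factor from \<open>trap_contraction\<close> times the mass 1 / rate of the
  kernel.\<close>

definition contraction_rate :: real where
  "contraction_rate = sqrt (rate\<^sup>2 - rate / (64 * C)) / rate"

lemma contraction_rate: "0 \<le> contraction_rate" "contraction_rate < 1"
proof -
  have "rate / (64 * C) \<le> rate * rate"
  proof -
    have "1 \<le> C ^ 3" using C by (intro one_le_power) simp
    moreover have "1 / (64 * C) \<le> 1" using C by simp
    ultimately have "1 / (64 * C) \<le> rate" by linarith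
    then have "rate * (1 / (64 * C)) \<le> rate * rate" using rate_pos by (intro mult_left_mono) auto
    then show ?thesis by simp
  qed
  then show "0 \<le> contraction_rate"
    using rate_pos by (simp add: contraction_rate_def power2_eq_square)
  have "rate / (64 * C) > 0" using C by simp
  then have "sqrt (rate\<^sup>2 - rate / (64 * C)) < sqrt (rate\<^sup>2)" by (intro real_sqrt_less_mono) linarith
  then show "contraction_rate < 1"
    using rate_pos by (simp only: contraction_rate_def divide_less_eq_1_pos real_sqrt_abs abs_of_pos)
qed

lemma trap_map_contraction:
  assumes w: "continuous_on UNIV w" "range w \<subseteq> trap C" and w': "continuous_on UNIV w'" "range w' \<subseteq> trap C"
    and d: "\<And>t. norm (w t - w' t) \<le> d"
  shows "norm (trap_map w x - trap_map w' x) \<le> contraction_rate * d"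
proof -
  let ?e = "\<lambda>t. exp (rate * (t - x))"
  let ?k = "sqrt (rate\<^sup>2 - rate / (64 * C))"
  let ?f = "\<lambda>t. ?e t *\<^sub>R (rate *\<^sub>R (w t - w' t) - (quad_root (w t) - quad_root (w' t)))"
  have f: "(?f has_integral trap_map w x - trap_map w' x) {..x}"
    using has_integral_diff[OF trap_map_has_integral[OF w] trap_map_has_integral[OF w'], of x]
    by (simp add: algebra_simps)
  have g: "((\<lambda>t. (?k * d) * ?e t) has_integral (?k * d) * (1 / rate)) {..x}"
    by (intro has_integral_mult_right exp_kernel_integrals rate_pos)
  have "norm (integral {..x} ?f) \<le> integral {..x} (\<lambda>t. (?k * d) * ?e t)"
  proof (rule Henstock_Kurzweil_Integration.integral_norm_bound_integral)
    fix t assume "t \<in> {..x}"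
    have "w t \<in> trap C" "w' t \<in> trap C" using w w' by blast+
    then have "norm (rate *\<^sub>R (w t - w' t) - (quad_root (w t) - quad_root (w' t))) \<le> ?k * norm (w t - w' t)"
      by (rule trap_contraction(1)[OF C])
    also have "\<dots> \<le> ?k * d"
    proof (rule mult_left_mono[OF d])
      show "?k \<ge> 0" using contraction_rate(1) rate_pos
        by (simp only: contraction_rate_def zero_le_divide_iff) linarith
    qed
    finally show "norm (?f t) \<le> (?k * d) * ?e t" by (simp add: mult.commute)
  qed (use f g in blast)+
  then show ?thesis
    using integral_unique[OF f] integral_unique[OF g] by (simp add: contraction_rate_def)
qed

text \<open>Banach's theorem in the complete space of continuous functions with values in the
  square. Although \<open>h\<close> is unbounded, \<open>trap_map w\<close> is bounded by
  \<open>trap_map_in_trap\<close>, so \<open>Bcontfun\<close> represents it faithfully for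
  \<open>w\<close> in \<open>s\<close>.\<close>

lemma trap_map_fixed_point:
  obtains w where "continuous_on UNIV w" "range w \<subseteq> trap C" "\<And>x. trap_map w x = w x"
proof -
  define s :: "(real \<Rightarrow>\<^sub>C (real ^ 2)) set" where "s = PiC UNIV (\<lambda>_. trap C)"
  define \<Phi> where "\<Phi> w = Bcontfun (trap_map (apply_bcontfun w))" for w
  have s: "continuous_on UNIV (apply_bcontfun w)" "range (apply_bcontfun w) \<subseteq> trap C" if "w \<in> s" for w
    using that by (auto simp: s_def mem_PiC_iff)
  have \<Phi>: "apply_bcontfun (\<Phi> w) = trap_map w" if "w \<in> s" for w
  proof -
    have "bounded (range (trap_map w))"
      using trap_map_in_trap[OF s[OF that]] bounded_cbox bounded_subset
      by (metis image_subsetI trap_eq_cbox)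
    then have "trap_map w \<in> bcontfun"
      using continuous_on_trap_map[OF s[OF that]] by (simp add: bcontfun_def)
    then show ?thesis by (simp add: \<Phi>_def Bcontfun_inverse)
  qed
  have "\<exists>!w\<in>s. \<Phi> w = w"
  proof (rule Banach_fix[OF _ _ contraction_rate])
    have "closed (trap C)" unfolding trap_eq_cbox by (rule closed_cbox)
    then show "complete s" unfolding s_def complete_eq_closed by (intro closed_PiC)
    have "1 / (4 * C\<^sup>2) \<le> 8 * C\<^sup>2"
    proof -
      have "1 \<le> C\<^sup>2" using C by simp
      moreover from this have "1 / (4 * C\<^sup>2) \<le> 1"
        using divide_le_eq_1_pos[of "4 * C\<^sup>2" 1] by linarith
      ultimately show ?thesis by linarith
    qed
    then have "const_bcontfun (\<chi> i. 8 * C\<^sup>2) \<in> s"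
      by (simp add: s_def mem_PiC_iff trap_def const_bcontfun.rep_eq)
    then show "s \<noteq> {}" by blast
    show "\<Phi> ` s \<subseteq> s"
    proof safe
      fix w assume "w \<in> s"
      then show "\<Phi> w \<in> s"
        using trap_map_in_trap[OF s[OF \<open>w \<in> s\<close>]] \<Phi>[OF \<open>w \<in> s\<close>] by (simp add: s_def mem_PiC_iff)
    qed
    show "dist (\<Phi> w) (\<Phi> w') \<le> contraction_rate * dist w w'" if "w \<in> s" "w' \<in> s" for w w'
    proof (rule dist_bound)
      fix x
      have "norm (trap_map w x - trap_map w' x) \<le> contraction_rate * dist w w'"
        using dist_bounded[of w _ w']
        by (intro trap_map_contraction s that) (simp add: dist_norm)
      then show "dist (\<Phi> w x) (\<Phi> w' x) \<le> contraction_rate * dist w w'"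
        by (simp add: \<Phi> that dist_norm)
    qed
  qed
  then obtain w where "w \<in> s" "\<Phi> w = w" by blast
  then have "trap_map w x = w x" for x using \<Phi> by metis
  then show thesis using that s[OF \<open>w \<in> s\<close>] by blast
qed

lemma classical_solution_exists:
  obtains u where "\<And>x. (u has_vector_derivative quad_root (h x - u x)) (at x)"
    "\<And>x. h x - u x \<in> trap C" "continuous_on UNIV (\<lambda>x. quad_root (h x - u x))"
proof -
  obtain w where w: "continuous_on UNIV w" "range w \<subseteq> trap C" and fix_w: "\<And>x. trap_map w x = w x"
    using trap_map_fixed_point by blast
  show thesis
  proof (rule that[of "\<lambda>x. h x - w x"])
    show "((\<lambda>x. h x - w x) has_vector_derivative quad_root (h x - (h x - w x))) (at x)" for x
      using trap_map_derivative[OF w, of x] by (simp add: fix_w forcing_def)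
    show "h x - (h x - w x) \<in> trap C" for x using w(2) by auto
    show "continuous_on UNIV (\<lambda>x. quad_root (h x - (h x - w x)))"
      using continuous_on_root_w[OF w] by simp
  qed
qed

end

text \<open>A bounded derivative makes \<open>u\<close> Lipschitz, which yields absolute continuity
  and linear growth; a continuous derivative leaves no jump to check.\<close>

lemma C1_solution_admissible:
  fixes u :: "real \<Rightarrow> real ^ 2"
  assumes der: "\<And>x. (u has_vector_derivative p x) (at x)" and cont: "continuous_on UNIV p"
    and bound: "\<And>x. norm (p x) \<le> M"
    and eqs: "\<And>x. u x $ 1 = h1 x - p x $ 1 * p x $ 2 - (p x $ 1)\<^sup>2 / 2"
      "\<And>x. u x $ 2 = h2 x - p x $ 1 * p x $ 2 - (p x $ 2)\<^sup>2 / 2"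
  shows "admissible_solution h1 h2 u"
proof -
  have "M \<ge> 0" using bound[of 0] norm_ge_zero order_trans by blast
  have vd: "vector_derivative u (at x) = p x" for x
    using der by (rule vector_derivative_at)
  have diffable: "u differentiable (at x)" for x
    using der differentiableI_vector by blast
  then have dp: "diff_points u = UNIV" by (simp add: diff_points_def)
  have lip: "norm (u y - u x) \<le> M * \<bar>y - x\<bar>" for x y
  proof -
    have "norm (u y - u x) \<le> M * norm (y - x)"
    proof (rule differentiable_bound[of UNIV])
      show "(u has_derivative (\<lambda>t. t *\<^sub>R p z)) (at z within UNIV)" for z
        using der[of z] by (simp add: has_vector_derivative_def)
      show "onorm (\<lambda>t. t *\<^sub>R p z) \<le> M" for z
        using bound[of z] by (intro onorm_le) (simp add: mult.commute[of "\<bar>_\<bar>"] mult_right_mono)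
    qed auto
    then show ?thesis by simp
  qed
  have ac: "abs_continuous_on {a..b} u" for a b
    unfolding abs_continuous_on_def
  proof (intro allI impI)
    fix e :: real assume "e > 0"
    show "\<exists>\<delta>>0. \<forall>\<D> T. \<D> division_of T \<and> T \<subseteq> {a..b} \<and> (\<Sum>K\<in>\<D>. Sup K - Inf K) < \<delta> \<longrightarrow>
        (\<Sum>K\<in>\<D>. norm (u (Sup K) - u (Inf K))) < e"
    proof (intro exI[of _ "e / (M + 1)"] conjI allI impI)
      show "e / (M + 1) > 0" using \<open>e > 0\<close> \<open>M \<ge> 0\<close> by simp
      fix \<D> T assume *: "\<D> division_of T \<and> T \<subseteq> {a..b} \<and> (\<Sum>K\<in>\<D>. Sup K - Inf K) < e / (M + 1)"
      have ordered: "Inf K \<le> Sup K" if K: "K \<in> \<D>" for K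
      proof -
        have "\<D> division_of T" using * by blast
        then obtain c d where "K = cbox c d" "K \<noteq> {}"
          using division_ofD(3)[OF _ K] division_ofD(4)[OF _ K] by metis
        then show ?thesis by simp
      qed
      have "(\<Sum>K\<in>\<D>. norm (u (Sup K) - u (Inf K))) \<le> (\<Sum>K\<in>\<D>. M * (Sup K - Inf K))"
      proof (rule sum_mono)
        show "norm (u (Sup K) - u (Inf K)) \<le> M * (Sup K - Inf K)" if "K \<in> \<D>" for K
          using lip[of "Sup K" "Inf K"] ordered[OF that] by simp
      qed
      also have "\<dots> = M * (\<Sum>K\<in>\<D>. Sup K - Inf K)" by (simp add: sum_distrib_left)
      also have "\<dots> \<le> M * (e / (M + 1))" using * \<open>M \<ge> 0\<close> by (intro mult_left_mono) auto
      also have "\<dots> < e" using \<open>e > 0\<close> \<open>M \<ge> 0\<close> by (simp add: field_simps)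
      finally show "(\<Sum>K\<in>\<D>. norm (u (Sup K) - u (Inf K))) < e" .
    qed
  qed
  have growth: "norm (u x) \<le> (norm (u 0) + M) * (1 + \<bar>x\<bar>)" for x
  proof -
    have "norm (u x) \<le> norm (u 0) + M * \<bar>x\<bar>"
      using lip[of x 0] norm_triangle_ineq2[of "u x" "u 0"] by simp
    also have "\<dots> \<le> (norm (u 0) + M) * (1 + \<bar>x\<bar>)" using \<open>M \<ge> 0\<close> by (simp add: algebra_simps)
    finally show ?thesis .
  qed
  have "(p \<longlongrightarrow> p y) (at y within S)" for y S
    using cont by (metis continuous_on tendsto_within_subset subset_UNIV UNIV_I)
  then have lims: "deriv_right_limit u y (p y)" "deriv_left_limit u y (p y)" "deriv_continuous_at u y" for y
    by (simp_all add: deriv_right_limit_def deriv_left_limit_def deriv_continuous_at_def vd dp continuous_within)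
  have "solves_at h1 h2 u x" for x
    using eqs[of x] diffable by (simp add: solves_at_def vd)
  then show ?thesis
    unfolding admissible_solution_def using ac growth lims by blast
qed

subsection \<open>Existence and uniqueness\<close>

lemma unique_admissible_solution:
  assumes C: "C > 1"
    and h1: "\<And>x y. x \<le> y \<Longrightarrow> (y - x) / C \<le> h1 y - h1 x" "\<And>x y. x \<le> y \<Longrightarrow> h1 y - h1 x \<le> C * (y - x)"
    and h2: "\<And>x y. x \<le> y \<Longrightarrow> (y - x) / C \<le> h2 y - h2 x" "\<And>x y. x \<le> y \<Longrightarrow> h2 y - h2 x \<le> C * (y - x)"
  shows "\<exists>!u :: real \<Rightarrow> real ^ 2. admissible_solution h1 h2 u"
proof -
  define h :: "real \<Rightarrow> real ^ 2" where "h x = vector [h1 x, h2 x]" for x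
  have h: "(y - x) / C \<le> h y $ i - h x $ i" "h y $ i - h x $ i \<le> C * (y - x)" if "x \<le> y" for x y i
    using h1[OF that] h2[OF that] exhaust_2[of i] by (auto simp: h_def)
  obtain u where der: "\<And>x. (u has_vector_derivative quad_root (h x - u x)) (at x)"
    and trap: "\<And>x. h x - u x \<in> trap C" and cont: "continuous_on UNIV (\<lambda>x. quad_root (h x - u x))"
    using classical_solution_exists[OF C h] by blast
  have "admissible_solution h1 h2 u"
  proof (rule C1_solution_admissible[OF der cont])
    fix x
    note b = trap_root_bounds[OF C trap[of x]]
    show "norm (quad_root (h x - u x)) \<le> 8 * C"
      using norm_le_l1_cart[of "quad_root (h x - u x)"] b(1)[of 1] b(1)[of 2] b(2)[of 1] b(2)[of 2]
      by (simp add: sum_2)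
    note r = quad_root[OF trap_pos[OF C trap[of x]] trap_pos[OF C trap[of x]]]
    show "u x $ 1 = h1 x - quad_root (h x - u x) $ 1 * quad_root (h x - u x) $ 2 - (quad_root (h x - u x) $ 1)\<^sup>2 / 2"
      using r(3) by (simp add: h_def)
    show "u x $ 2 = h2 x - quad_root (h x - u x) $ 1 * quad_root (h x - u x) $ 2 - (quad_root (h x - u x) $ 2)\<^sup>2 / 2"
      using r(4) by (simp add: h_def)
  qed
  then show ?thesis
    using admissible_solution_unique[OF _ _ C h1 h2] by (intro ex1I[of _ u]) blast+
qed

text \<open>By continuity of \<open>h\<close> the mean value theorem applies on intervals whose
  interior misses \<open>S\<close>, even if an endpoint lies in \<open>S\<close>. As
  \<open>S\<close> is finite, each point has such intervals on both sides, and the estimates add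
  up.\<close>

lemma slope_bounds_from_deriv:
  fixes h :: "real \<Rightarrow> real"
  assumes "finite S" "continuous_on UNIV h" "x \<le> y"
    and diff: "\<And>t. t \<notin> S \<Longrightarrow> h differentiable (at t)"
    and bounds: "\<And>t. t \<notin> S \<Longrightarrow> l \<le> deriv h t \<and> deriv h t \<le> m"
  shows "l * (y - x) \<le> h y - h x \<and> h y - h x \<le> m * (y - x)"
proof -
  have incr: "l * (d - c) \<le> h d - h c \<and> h d - h c \<le> m * (d - c)"
    if "c < d" "{c<..<d} \<inter> S = {}" for c d
  proof -
    have der: "(h has_real_derivative deriv h t) (at t)" if "c < t" "t < d" for t
    proof -
      have "t \<notin> S" using \<open>{c<..<d} \<inter> S = {}\<close> that greaterThanLessThan_iff by blast
      then show ?thesis using diff by (simp add: DERIV_deriv_iff_real_differentiable)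
    qed
    have "continuous_on {c..d} h" using assms(2) continuous_on_subset by blast
    then obtain t where t: "c < t" "t < d" "h d - h c = (d - c) * deriv h t"
      using MVT[OF \<open>c < d\<close>, of h] der by (metis DERIV_imp_deriv real_differentiable_def)
    have "t \<notin> S" using \<open>{c<..<d} \<inter> S = {}\<close> t greaterThanLessThan_iff by blast
    then have "l \<le> deriv h t" "deriv h t \<le> m" using bounds by auto
    then show ?thesis using t \<open>c < d\<close> by (auto simp: mult.commute intro: mult_left_mono)
  qed
  have gap: "\<forall>\<^sub>F s in at z. s \<notin> S" for z
    using \<open>finite S\<close> by (metis eventually_at_filter finite_imp_closed islimpt_finite islimpt_iff_eventually)
  show ?thesis
  proof (rule local_to_global[OF \<open>x \<le> y\<close>])
    fix z
    show "\<forall>\<^sub>F s in at_left z. l * (z - s) \<le> h z - h s \<and> h z - h s \<le> m * (z - s)"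
    proof -
      obtain c where c: "c < z" "\<forall>s>c. s < z \<longrightarrow> s \<notin> S"
        using gap[of z] by (auto simp: eventually_at_split eventually_at_left_field)
      then have "l * (z - s) \<le> h z - h s \<and> h z - h s \<le> m * (z - s)" if "c < s" "s < z" for s
        using that by (intro incr) auto
      then show ?thesis using c(1) by (auto simp: eventually_at_left_field)
    qed
    show "\<forall>\<^sub>F t in at_right z. l * (t - z) \<le> h t - h z \<and> h t - h z \<le> m * (t - z)"
    proof -
      obtain c where c: "c > z" "\<forall>t>z. t < c \<longrightarrow> t \<notin> S"
        using gap[of z] by (auto simp: eventually_at_split eventually_at_right_field)
      then have "l * (t - z) \<le> h t - h z \<and> h t - h z \<le> m * (t - z)" if "z < t" "t < c" for t
        using that by (intro incr) auto
      then show ?thesis using c(1) by (auto simp: eventually_at_right_field)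
    qed
  qed (auto simp: algebra_simps)
qed

lemma in_some_einterval:
  fixes x :: "nat \<Rightarrow> ereal"
  assumes "x 0 = -\<infinity>" "x (N + 1) = \<infinity>" "ereal t \<notin> x ` {1..N}"
  shows "\<exists>j\<in>{0..N}. t \<in> einterval (x j) (x (j + 1))"
proof -
  \<comment> \<open>The piece containing \<open>t\<close> ends at the first break point beyond
    \<open>t\<close>; \<open>k\<close> is not 0 because x 0 is minus infinity.\<close>
  define k where "k = (LEAST k. ereal t < x k)"
  have top: "ereal t < x (N + 1)" using assms(2) by simp
  then have k: "ereal t < x k" unfolding k_def by (rule LeastI)
  have "k \<le> N + 1" unfolding k_def using top by (rule Least_le)
  have "k \<noteq> 0"
  proof
    assume "k = 0"
    then have "ereal t < x 0" using k by simp
    then show False using assms(1) by simp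
  qed
  then obtain j where j: "k = j + 1" using not0_implies_Suc by auto
  have "\<not> ereal t < x j" using not_less_Least[of j "\<lambda>k. ereal t < x k"] j k_def by simp
  moreover have "x j \<noteq> ereal t"
  proof (cases "j = 0")
    case False
    then have "x j \<in> x ` {1..N}" using \<open>k \<le> N + 1\<close> j by (intro imageI) simp
    then show ?thesis using assms(3) by auto
  qed (use assms(1) in simp)
  ultimately have "x j < ereal t" by simp
  then show ?thesis using k j \<open>k \<le> N + 1\<close> by (intro bexI[of _ j]) (auto simp: einterval_def)
qed

theorem theorem5:
  fixes C :: real
  assumes "C > 1"
  shows "\<exists>\<delta>::real. \<delta> > 0 \<and>
    (\<forall>(N::nat) (x :: nat \<Rightarrow> ereal) (h1 :: real \<Rightarrow> real) (h2 :: real \<Rightarrow> real).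
       N \<ge> 1 \<and>
       x 0 = -\<infinity> \<and> x (N + 1) = \<infinity> \<and> strict_mono_on {0..N + 1} x \<and>
       continuous_on UNIV h1 \<and> continuous_on UNIV h2 \<and>
       (\<forall>j\<in>{0..N}. smooth_on (einterval (x j) (x (j + 1))) h1 \<and>
                    smooth_on (einterval (x j) (x (j + 1))) h2) \<and>
       (\<forall>t. ereal t \<notin> x ` {1..N} \<longrightarrow>
              1 / C \<le> deriv h1 t \<and> deriv h1 t \<le> C \<and>
              1 / C \<le> deriv h2 t \<and> deriv h2 t \<le> C) \<and>
       (\<forall>\<xi>\<in>einterval (-\<infinity>) (x 1). \<forall>\<eta>\<in>einterval (-\<infinity>) (x 1).
              \<bar>deriv h1 \<xi> - deriv h1 \<eta>\<bar> \<le> \<delta> \<and>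
              \<bar>deriv h2 \<xi> - deriv h2 \<eta>\<bar> \<le> \<delta>)
       \<longrightarrow> (\<exists>!u :: real \<Rightarrow> real ^ 2. admissible_solution h1 h2 u))"
proof (intro exI[of _ 1] conjI allI impI)
  fix N :: nat and x :: "nat \<Rightarrow> ereal" and h1 h2 :: "real \<Rightarrow> real"
  assume "N \<ge> 1 \<and>
       x 0 = -\<infinity> \<and> x (N + 1) = \<infinity> \<and> strict_mono_on {0..N + 1} x \<and>
       continuous_on UNIV h1 \<and> continuous_on UNIV h2 \<and>
       (\<forall>j\<in>{0..N}. smooth_on (einterval (x j) (x (j + 1))) h1 \<and>
                    smooth_on (einterval (x j) (x (j + 1))) h2) \<and>
       (\<forall>t. ereal t \<notin> x ` {1..N} \<longrightarrow>
              1 / C \<le> deriv h1 t \<and> deriv h1 t \<le> C \<and>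
              1 / C \<le> deriv h2 t \<and> deriv h2 t \<le> C) \<and>
       (\<forall>\<xi>\<in>einterval (-\<infinity>) (x 1). \<forall>\<eta>\<in>einterval (-\<infinity>) (x 1).
              \<bar>deriv h1 \<xi> - deriv h1 \<eta>\<bar> \<le> 1 \<and>
              \<bar>deriv h2 \<xi> - deriv h2 \<eta>\<bar> \<le> 1)"
  then have ends: "x 0 = -\<infinity>" "x (N + 1) = \<infinity>"
    and cont: "continuous_on UNIV h1" "continuous_on UNIV h2"
    and smooth: "\<And>j. j \<in> {0..N} \<Longrightarrow> smooth_on (einterval (x j) (x (j + 1))) h1 \<and>
        smooth_on (einterval (x j) (x (j + 1))) h2"
    and bounds: "\<And>t. ereal t \<notin> x ` {1..N} \<Longrightarrow> 1 / C \<le> deriv h1 t \<and> deriv h1 t \<le> C \<and>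
        1 / C \<le> deriv h2 t \<and> deriv h2 t \<le> C"
    by blast+
  \<comment> \<open>The break points as real numbers. Off this finite set the case k = 0 of
    \<open>smooth_on\<close> gives differentiability.\<close>
  define S where "S = {t. ereal t \<in> x ` {1..N}}"
  have "S \<subseteq> real_of_ereal ` x ` {1..N}"
  proof
    fix t assume "t \<in> S"
    then have "real_of_ereal (ereal t) \<in> real_of_ereal ` x ` {1..N}" by (simp only: S_def mem_Collect_eq imageI)
    then show "t \<in> real_of_ereal ` x ` {1..N}" by simp
  qed
  then have "finite S" by (rule finite_subset) simp
  have diff: "h1 differentiable (at t) \<and> h2 differentiable (at t)" if "t \<notin> S" for t
  proof -
    have "ereal t \<notin> x ` {1..N}" using that by (simp add: S_def)
    then obtain j where j: "j \<in> {0..N}" "t \<in> einterval (x j) (x (j + 1))"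
      using in_some_einterval[OF ends] by blast
    show ?thesis
      using smooth[OF j(1)] j(2) unfolding smooth_on_def by (metis funpow_0)
  qed
  have slope1: "1 / C * (z - y) \<le> h1 z - h1 y \<and> h1 z - h1 y \<le> C * (z - y)" if "y \<le> z" for y z
    by (rule slope_bounds_from_deriv[OF \<open>finite S\<close> cont(1) that]) (use diff bounds in \<open>auto simp: S_def\<close>)
  have slope2: "1 / C * (z - y) \<le> h2 z - h2 y \<and> h2 z - h2 y \<le> C * (z - y)" if "y \<le> z" for y z
    by (rule slope_bounds_from_deriv[OF \<open>finite S\<close> cont(2) that]) (use diff bounds in \<open>auto simp: S_def\<close>)
  show "\<exists>!u :: real \<Rightarrow> real ^ 2. admissible_solution h1 h2 u"
    by (rule unique_admissible_solution[OF assms]) (use slope1 slope2 in auto)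
qed simp

end
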